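(* Let $G$ be a connected graph with $n$ vertices, $m$ edges and diameter $d$ (so $n-1\le m\le\binom{n-d}{2}+2n-d-2$). (1) If $d$ is odd and $2n-2-d\le m\le \binom{n-d}{2}+n-1$, then $\sigma_2(G)\ge \frac{7d^3-d+6}{12}+(m-d)\frac{(d+1)^2}{4}$. If $d$ is odd and $m=2n-2-d-k$ or $m=\binom{n-d}{2}+n-1+k$ with $1\le k\le n-d-1$, then $\sigma_2(G)\ge \frac{7d^3-d+6}{12}+(m-d)\frac{(d+1)^2}{4}+k\frac{d+1}{2}$. (2) If $d$ is even with $d\ge4$, let $\mu_j=n-1+\binom j2+2j$ and let $k$ be the least nonnegative integer with $m\le\mu_k$. Then $\sigma_2(G)\ge\frac{7d^3-4d}{12}+(m-d)\frac{d^2}{4}+(n-1-d+k)\frac d2$. (3) If $d=2$, let $\nu_j=\binom j2+j(n-j)$ and let $k\ge0$ be such that $\nu_k\le m<\nu_{k+1}$. Then $\sigma_2(G)\ge\binom k2+2k(n-k)+4(m-\nu_k)$. Each of these lower bounds is attained by some connected $n$-vertex graph with $m$ edges and diameter $d$, except when $d=4$, $m=n$ and $n\ge7$, in which case the minimum of $\sigma_2$ equals the bound in (2) plus $3$.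
   Context: All graphs are finite, simple, undirected. For a connected graph $G$ and $u\in V(G)$, the eccentricity $\varepsilon_G(u)=\max_{v\in V(G)} d_G(u,v)$; the diameter is $\max_u\varepsilon_G(u)$. The second Zagreb eccentricity index is $\sigma_2(G)=\sum_{uv\in E(G)}\varepsilon_G(u)\varepsilon_G(v)$. *)

theory Defs
  imports Complex_Main
begin

definition simple_graph :: "'a set \<Rightarrow> 'a set set \<Rightarrow> bool" where
  "simple_graph V E \<longleftrightarrow> finite V \<and> (\<forall>e\<in>E. e \<subseteq> V \<and> card e = 2)"

definition walk :: "'a set set \<Rightarrow> 'a list \<Rightarrow> bool" where
  "walk E p \<longleftrightarrow> p \<noteq> [] \<and> (\<forall>i. i + 1 < length p \<longrightarrow> {p ! i, p ! (i + 1)} \<in> E)"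

definition connected_graph :: "'a set \<Rightarrow> 'a set set \<Rightarrow> bool" where
  "connected_graph V E \<longleftrightarrow> simple_graph V E \<and> V \<noteq> {} \<and>
     (\<forall>u\<in>V. \<forall>v\<in>V. \<exists>p. walk E p \<and> hd p = u \<and> last p = v)"

definition gdist :: "'a set set \<Rightarrow> 'a \<Rightarrow> 'a \<Rightarrow> nat" where
  "gdist E u v = (LEAST k. \<exists>p. walk E p \<and> hd p = u \<and> last p = v \<and> length p = k + 1)"

definition ecc :: "'a set \<Rightarrow> 'a set set \<Rightarrow> 'a \<Rightarrow> nat" where
  "ecc V E u = Max (gdist E u ` V)"

definition diam :: "'a set \<Rightarrow> 'a set set \<Rightarrow> nat" where
  "diam V E = Max (ecc V E ` V)"

definition sigma2 :: "'a set \<Rightarrow> 'a set set \<Rightarrow> nat" where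
  "sigma2 V E = (\<Sum>e\<in>E. \<Prod>u\<in>e. ecc V E u)"

definition cgraph_params :: "'a set \<Rightarrow> 'a set set \<Rightarrow> nat \<Rightarrow> nat \<Rightarrow> nat \<Rightarrow> bool" where
  "cgraph_params V E n m d \<longleftrightarrow> connected_graph V E \<and> card V = n \<and> card E = m \<and> diam V E = d"

end

theory Submission
  imports Defs
begin

text \<open>
  Fix a diametral path \<open>P 0, \<dots>, P d\<close> and put \<open>r = \<lceil>d / 2\<rceil>\<close>. All eccentricities are at least \<open>r\<close>, the
  path edges contribute at least \<open>path_sum d\<close>, and each of the \<open>m - d\<close> other edges contributes at
  least \<open>r\<^sup>2\<close>, with a surplus of at least \<open>r\<close> if it is bad, i.e. has an end of eccentricity larger
  than \<open>r\<close>. So everything reduces to counting bad edges. From below, one lets every vertex off the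
  path claim edges leading towards the ends of the path: all claimed edges are distinct, and those
  of vertices not in the centre are bad (for even \<open>d\<close> all of them are). From above, an edge that
  is not bad joins two of the few vertices of eccentricity \<open>r\<close>. In diameter two the sum is
  determined by the number of dominating vertices.
\<close>

section \<open>Distances and walks\<close>

text \<open>Write \<open>t = n - 1 - d\<close> and \<open>M = m - d\<close> for the numbers of
  vertices and edges off the path, and \<open>beta\<close> for the number of bad edges. For odd
  \<open>d\<close> the two counts read \<open>beta >= 2 t - M\<close> and
  \<open>beta >= M - C(t,2) - 2 t\<close>. The values of \<open>m\<close> for which neither says
  anything form exactly the middle range of (1), and on either side of it the shortfall is the
  \<open>k\<close> of the statement. For even \<open>d\<close> the number \<open>q\<close> of
  off-path vertices of eccentricity \<open>r\<close> is unknown. Claims give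
  \<open>beta >= t + q\<close>, whereas few such vertices leave few good edges,
  \<open>beta >= M - C(q + 1, 2)\<close>. Balancing the two yields the \<open>k\<close> of (2). The
  exceptional case has a geometric origin. For \<open>M = t + 1\<close> the natural extremal graph
  has one vertex joined to both sides of the centre but not to the centre, and leaves at the centre
  otherwise. That vertex has distance 3 from the leaves, which exceeds the eccentricity 2 that it
  should have when \<open>d = 4\<close>.\<close>

definition adj :: "'a set set \<Rightarrow> ('a \<times> 'a) set" where
  "adj E = {(x, y). {x, y} \<in> E}"

lemma adj_iff [simp]: "(x, y) \<in> adj E \<longleftrightarrow> {x, y} \<in> E"
  by (simp add: adj_def)

text \<open>Relational powers replace lists from here on: \<open>relpow_add\<close> yields the
  triangle inequality, and unfolding \<open>Suc\<close> yields the last edge of a shortest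
  walk.\<close>

lemma walk_iff_relpow:
  "(\<exists>p. walk E p \<and> hd p = u \<and> last p = v \<and> length p = k + 1) \<longleftrightarrow> (u, v) \<in> adj E ^^ k"
proof
  assume "\<exists>p. walk E p \<and> hd p = u \<and> last p = v \<and> length p = k + 1"
  then obtain p where p: "walk E p" "hd p = u" "last p = v" "length p = k + 1" by blast
  then have "p \<noteq> []" by auto
  with p show "(u, v) \<in> adj E ^^ k"
    unfolding relpow_fun_conv
    by (intro exI[of _ "\<lambda>i. p ! i"]) (auto simp: hd_conv_nth last_conv_nth walk_def)
next
  assume "(u, v) \<in> adj E ^^ k"
  then obtain f where f: "f 0 = u" "f k = v" "\<forall>i<k. {f i, f (Suc i)} \<in> E"
    unfolding relpow_fun_conv by auto
  let ?p = "map f [0..<k+1]"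
  have "walk E ?p \<and> hd ?p = u \<and> last ?p = v \<and> length ?p = k + 1"
    using f by (auto simp: walk_def hd_map last_map nth_append simp del: upt_Suc)
  then show "\<exists>p. walk E p \<and> hd p = u \<and> last p = v \<and> length p = k + 1" by blast
qed

lemma gdist_eq_Least: "gdist E u v = (LEAST k. (u, v) \<in> adj E ^^ k)"
  unfolding gdist_def walk_iff_relpow ..

lemma connected_graph_iff:
  "connected_graph V E \<longleftrightarrow> simple_graph V E \<and> V \<noteq> {} \<and> (\<forall>u\<in>V. \<forall>v\<in>V. \<exists>k. (u, v) \<in> adj E ^^ k)"
proof -
  have "(\<exists>p. walk E p \<and> hd p = u \<and> last p = v) \<longleftrightarrow> (\<exists>k. (u, v) \<in> adj E ^^ k)" for u v :: 'a
  proof -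
    have "(\<exists>p. walk E p \<and> hd p = u \<and> last p = v) \<longleftrightarrow>
      (\<exists>k p. walk E p \<and> hd p = u \<and> last p = v \<and> length p = k + 1)"
      by (metis One_nat_def Suc_eq_plus1 length_0_conv not0_implies_Suc walk_def)
    then show ?thesis unfolding walk_iff_relpow .
  qed
  then show ?thesis unfolding connected_graph_def by simp
qed

lemma gdist_le: "(u, v) \<in> adj E ^^ k \<Longrightarrow> gdist E u v \<le> k"
  unfolding gdist_eq_Least by (rule Least_le)

lemma relpow_adj_sym: "(u, v) \<in> adj E ^^ k \<Longrightarrow> (v, u) \<in> adj E ^^ k"
proof (induction k arbitrary: v)
  case (Suc k)
  then obtain y where "(u, y) \<in> adj E ^^ k" "{y, v} \<in> E" by auto
  then have "(v, y) \<in> adj E" "(y, u) \<in> adj E ^^ k" using Suc.IH by (auto simp: insert_commute)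
  then show ?case by (rule relpow_Suc_I2)
qed auto

lemma gdist_sym: "gdist E u v = gdist E v u"
  unfolding gdist_eq_Least by (metis relpow_adj_sym)

lemma gdist_self [simp]: "gdist E u u = 0"
  using gdist_le[where k = 0 and u = u and v = u] by simp

text \<open>A potential that grows by at most one along each edge certifies a lower bound on
  distances. In the explicit graphs it is applied to the candidate distances to the two ends of the
  path.\<close>

lemma relpow_adj_lipschitz:
  fixes f :: "'a \<Rightarrow> int"
  assumes "(u, v) \<in> adj E ^^ k" and "\<And>x y. {x, y} \<in> E \<Longrightarrow> f y \<le> f x + 1"
  shows "f v \<le> f u + int k"
  using assms(1)
proof (induction k arbitrary: v)
  case (Suc k)
  then obtain y where "(u, y) \<in> adj E ^^ k" "{y, v} \<in> E" by auto
  then show ?case using Suc.IH[of y] assms(2)[of y v] by simp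
qed auto

locale conn_graph =
  fixes V :: "'a set" and E :: "'a set set"
  assumes connected: "connected_graph V E"
begin

lemma finV [simp]: "finite V" and Vne: "V \<noteq> {}"
  using connected by (auto simp: connected_graph_def simple_graph_def)

lemma edgeD: "e \<in> E \<Longrightarrow> e \<subseteq> V \<and> card e = 2"
  using connected by (auto simp: connected_graph_def simple_graph_def)

lemma edge_pairD: "{x, y} \<in> E \<Longrightarrow> x \<in> V \<and> y \<in> V \<and> x \<noteq> y"
  using edgeD[of "{x, y}"] by (cases "x = y") auto

lemma finE [simp]: "finite E"
  by (rule finite_subset[of _ "Pow V"]) (use edgeD in auto)

lemma edgeE:
  assumes "e \<in> E" obtains x y where "e = {x, y}" "x \<noteq> y" "x \<in> V" "y \<in> V"
  using edgeD[OF assms] by (auto simp: card_2_iff)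

lemma gdist_relpow:
  assumes "u \<in> V" "v \<in> V" shows "(u, v) \<in> adj E ^^ gdist E u v"
proof -
  obtain k where "(u, v) \<in> adj E ^^ k" using connected assms unfolding connected_graph_iff by blast
  then show ?thesis unfolding gdist_eq_Least by (rule LeastI)
qed

lemma gdist_eq_0: "u \<in> V \<Longrightarrow> v \<in> V \<Longrightarrow> gdist E u v = 0 \<longleftrightarrow> u = v"
  using gdist_relpow[of u v] by auto

lemma gdist_triangle:
  assumes "u \<in> V" "v \<in> V" "w \<in> V" shows "gdist E u w \<le> gdist E u v + gdist E v w"
  by (rule gdist_le) (use gdist_relpow assms in \<open>auto simp: relpow_add\<close>)

lemma gdist_edge: "{u, v} \<in> E \<Longrightarrow> gdist E u v = 1"
  using gdist_le[where k = 1 and u = u and v = v and E = E] edge_pairD[of u v] gdist_eq_0[of u v] by auto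

lemma gdist_edge_le: "{u, v} \<in> E \<Longrightarrow> w \<in> V \<Longrightarrow> gdist E w v \<le> gdist E w u + 1"
  using gdist_triangle[of w u v] gdist_edge[of u v] edge_pairD[of u v] by simp

lemma gdist_pred:
  assumes "u \<in> V" "v \<in> V" "u \<noteq> v"
  obtains x where "x \<in> V" "{x, v} \<in> E" "gdist E u v = Suc (gdist E u x)"
proof -
  obtain k where k: "gdist E u v = Suc k" using assms gdist_eq_0 by (metis not0_implies_Suc)
  then have "(u, v) \<in> adj E ^^ Suc k" using gdist_relpow assms by metis
  then obtain x where x: "(u, x) \<in> adj E ^^ k" "{x, v} \<in> E" by auto
  then have "gdist E u x \<le> k" by (simp add: gdist_le)
  moreover have "gdist E u v \<le> gdist E u x + 1" using gdist_edge_le[OF x(2) assms(1)] .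
  ultimately show ?thesis using that x(2) k edge_pairD[of x v] by force
qed

lemma gdist_eq_1: "u \<in> V \<Longrightarrow> v \<in> V \<Longrightarrow> gdist E u v = 1 \<longleftrightarrow> {u, v} \<in> E"
  using gdist_relpow[of u v] gdist_edge[of u v] by fastforce

lemma gdist_le_ecc: "u \<in> V \<Longrightarrow> v \<in> V \<Longrightarrow> gdist E u v \<le> ecc V E u"
  unfolding ecc_def by auto

lemma ecc_attained: "\<exists>v\<in>V. gdist E u v = ecc V E u"
proof -
  have "Max (gdist E u ` V) \<in> gdist E u ` V" using Vne by (intro Max_in) auto
  then show ?thesis unfolding ecc_def by force
qed

lemma ecc_le_diam: "u \<in> V \<Longrightarrow> ecc V E u \<le> diam V E"
  unfolding diam_def by auto

lemma diam_attained: "\<exists>u\<in>V. ecc V E u = diam V E"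
proof -
  have "Max (ecc V E ` V) \<in> ecc V E ` V" using Vne by (intro Max_in) auto
  then show ?thesis unfolding diam_def by force
qed

end

section \<open>Counting edges off a diametral path\<close>

definition path_sum :: "nat \<Rightarrow> nat" where
  "path_sum d = (\<Sum>i<d. max i (d - i) * max (Suc i) (d - Suc i))"

text \<open>With \<open>x = D - i\<close> the sum telescopes, since
  \<open>3 x (x - 1) = (x + 1) x (x - 1) - x (x - 1) (x - 2)\<close>. The bound
  \<open>s <= D\<close> keeps the truncated differences exact.\<close>

lemma sum_falling:
  assumes "s \<le> D"
  shows "3 * (\<Sum>i<s. real (D - i) * real (D - Suc i)) =
    (real D + 1) * D * (real D - 1) - (real D - s + 1) * (real D - s) * (real D - s - 1)"
  using assms
proof (induction s)
  case (Suc s)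
  then have eq: "real (D - s) = real D - s" "real (D - Suc s) = real D - s - 1" by (auto simp: of_nat_diff)
  from Suc have IH: "3 * (\<Sum>i<s. real (D - i) * real (D - Suc i)) =
    (real D + 1) * D * (real D - 1) - (real D - s + 1) * (real D - s) * (real D - s - 1)" by simp
  show ?case unfolding sum.lessThan_Suc distrib_left[of 3] IH eq of_nat_Suc by algebra
qed simp

lemma sum_rising:
  "3 * (\<Sum>i<s. real (r + i) * real (Suc (r + i))) =
  (real r + s + 1) * (real r + s) * (real r + s - 1) - (real r + 1) * r * (real r - 1)"
proof (induction s)
  case (Suc s)
  show ?case unfolding sum.lessThan_Suc distrib_left[of 3] Suc unfolding of_nat_Suc of_nat_add by algebra
qed simp

lemma sum_lessThan_add:
  fixes f :: "nat \<Rightarrow> 'b :: comm_monoid_add"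
  shows "(\<Sum>i<a + b. f i) = (\<Sum>i<a. f i) + (\<Sum>i<b. f (a + i))"
  by (induction b) (simp_all add: add.assoc)

text \<open>The path is cut at its centre: the distance to the farther end falls from
  \<open>2 * r\<close> to \<open>r\<close> and then rises back.\<close>

lemma path_sum_even: "3 * real (path_sum (2 * r)) = 14 * real r ^ 3 - 2 * real r"
proof -
  have "real (path_sum (2 * r)) = (\<Sum>i<r + r. real (max i (r + r - i)) * real (max (Suc i) (r + r - Suc i)))"
    unfolding path_sum_def mult_2 of_nat_sum of_nat_mult ..
  also have "\<dots> = (\<Sum>i<r. real (r + r - i) * real (r + r - Suc i)) + (\<Sum>i<r. real (r + i) * real (Suc (r + i)))"
    unfolding sum_lessThan_add
    by (intro arg_cong2[where f = "(+)"] sum.cong refl arg_cong2[where f = "(*)"] arg_cong[where f = real]) auto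
  finally have eq: "real (path_sum (2 * r)) = \<dots>" .
  show ?thesis unfolding eq distrib_left[of 3] sum_rising sum_falling[OF le_add1] unfolding of_nat_add by algebra
qed

text \<open>The middle edge belongs to neither monotone half; both its ends have distance
  \<open>r + 1\<close> to the farther end, so it adds \<open>(r + 1) * (r + 1)\<close>.\<close>

lemma path_sum_odd:
  "3 * real (path_sum (2 * r + 1)) = 14 * real r ^ 3 + 21 * real r ^ 2 + 10 * real r + 3"
proof -
  let ?f = "\<lambda>i. real (max i (r + Suc r - i)) * real (max (Suc i) (r + Suc r - Suc i))"
  have "2 * r + 1 = r + Suc r" by simp
  then have "real (path_sum (2 * r + 1)) = (\<Sum>i<r + Suc r. ?f i)"
    unfolding path_sum_def of_nat_sum of_nat_mult by presburger
  also have "\<dots> = (\<Sum>i<r. ?f i) + (?f (r + 0) + (\<Sum>i<r. ?f (r + Suc i)))"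
    unfolding sum_lessThan_add sum.lessThan_Suc_shift ..
  also have "?f (r + 0) = (real r + 1) * (real r + 1)" by (simp add: max_def add.commute)
  also have "(\<Sum>i<r. ?f i) = (\<Sum>i<r. real (r + Suc r - i) * real (r + Suc r - Suc i))"
    by (intro sum.cong refl arg_cong2[where f = "(*)"] arg_cong[where f = real]) auto
  also have "(\<Sum>i<r. ?f (r + Suc i)) = (\<Sum>i<r. real (Suc r + i) * real (Suc (Suc r + i)))"
    by (intro sum.cong refl arg_cong2[where f = "(*)"] arg_cong[where f = real]) auto
  finally have eq: "real (path_sum (2 * r + 1)) =
    (\<Sum>i<r. real (r + Suc r - i) * real (r + Suc r - Suc i)) +
    ((real r + 1) * (real r + 1) + (\<Sum>i<r. real (Suc r + i) * real (Suc (Suc r + i))))" .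
  show ?thesis unfolding eq distrib_left[of 3] sum_rising sum_falling[OF le_add1]
    unfolding of_nat_add of_nat_Suc by algebra
qed

section \<open>Geometry of a fixed diametral path\<close>

locale diametral = conn_graph V E for V :: "'a set" and E +
  fixes P :: "nat \<Rightarrow> 'a" and d :: nat
  assumes P0: "P 0 \<in> V" and edgeP: "i < d \<Longrightarrow> {P i, P (Suc i)} \<in> E"
    and distP: "gdist E (P 0) (P d) = d" and diam_eq: "diam V E = d"
begin

abbreviation "eps \<equiv> ecc V E"
abbreviation "a x \<equiv> gdist E (P 0) x"
abbreviation "b x \<equiv> gdist E (P d) x"

definition "T = V - P ` {..d}"
definition "PE = (\<lambda>i. {P i, P (Suc i)}) ` {..<d}"
definition "N = E - PE"

lemma P_V: "i \<le> d \<Longrightarrow> P i \<in> V"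
  using P0 edgeP[of "i - 1"] edge_pairD[of "P (i - 1)" "P i"] by (cases i) auto

lemma dist_P: "i + j \<le> d \<Longrightarrow> gdist E (P i) (P (i + j)) \<le> j"
proof (induction j)
  case (Suc j)
  then have "{P (i + j), P (i + Suc j)} \<in> E" using edgeP[of "i + j"] by simp
  then show ?case using gdist_edge_le[of "P (i + j)" "P (i + Suc j)" "P i"] Suc P_V[of i] by simp
qed simp

lemma ab_ge: "x \<in> V \<Longrightarrow> d \<le> a x + b x"
  using gdist_triangle[of "P 0" x "P d"] gdist_sym[of E x "P d"] P_V[of 0] P_V[of d] distP by simp

text \<open>Walking along the path bounds the two distances by \<open>i\<close> and
  \<open>d - i\<close>; as their sum is at least \<open>d\<close>, both bounds are equalities. So
  the walk is a geodesic although only the distance of its ends is assumed.\<close>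

lemma a_P: "i \<le> d \<Longrightarrow> a (P i) = i" and b_P: "i \<le> d \<Longrightarrow> b (P i) = d - i"
  using dist_P[of 0 i] dist_P[of i "d - i"] ab_ge[of "P i"] P_V[of i] gdist_sym[of E "P i" "P d"] by auto

lemma a_le_eps: "x \<in> V \<Longrightarrow> a x \<le> eps x" and b_le_eps: "x \<in> V \<Longrightarrow> b x \<le> eps x"
  using gdist_le_ecc[of x "P 0"] gdist_le_ecc[of x "P d"] P_V[of 0] P_V[of d]
  by (simp_all add: gdist_sym[of E x])

lemma eps_le: "x \<in> V \<Longrightarrow> eps x \<le> d"
  using ecc_le_diam diam_eq by simp

lemma eps_P: "i \<le> d \<Longrightarrow> max i (d - i) \<le> eps (P i)"
  using a_le_eps[OF P_V[of i]] b_le_eps[OF P_V[of i]] a_P b_P by simp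

text \<open>The distances from \<open>x\<close> to the two ends sum to at least \<open>d\<close>, so
  one of them is at least \<open>d / 2\<close>. The hypothesis admits every \<open>r\<close> up to
  this value rounded up.\<close>

lemma eps_ge: "x \<in> V \<Longrightarrow> 2 * r \<le> d + 1 \<Longrightarrow> r \<le> eps x"
  using ab_ge[of x] a_le_eps[of x] b_le_eps[of x] by simp

lemma inj_P: "inj_on P {..d}"
  by (rule inj_onI) (metis a_P atMost_iff)

lemma inj_PE: "inj_on (\<lambda>i. {P i, P (Suc i)}) {..<d}"
proof (rule inj_onI)
  fix i j assume ij: "i \<in> {..<d}" "j \<in> {..<d}" "{P i, P (Suc i)} = {P j, P (Suc j)}"
  then have "a ` {P i, P (Suc i)} = a ` {P j, P (Suc j)}" by simp
  moreover have "a ` {P k, P (Suc k)} = {k, Suc k}" if "k < d" for k using a_P that by simp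
  ultimately have "{i, Suc i} = {j, Suc j}" using ij by (metis lessThan_iff)
  then show "i = j" by (auto simp: doubleton_eq_iff)
qed

lemma PE_sub: "PE \<subseteq> E" using edgeP by (auto simp: PE_def)

lemma card_PE: "card PE = d" unfolding PE_def using card_image[OF inj_PE] by simp

lemma finite_PE [simp]: "finite PE" and finN [simp]: "finite N" and finT [simp]: "finite T"
  by (auto simp: PE_def N_def T_def)

lemma N_E: "e \<in> N \<Longrightarrow> e \<in> E" by (simp add: N_def)

lemma T_V: "x \<in> T \<Longrightarrow> x \<in> V" by (simp add: T_def)

lemma card_N: "card E = d + card N"
  unfolding N_def using card_Diff_subset[OF finite_PE PE_sub] card_PE card_mono[OF finE PE_sub] by simp

lemma card_T: "card V = d + 1 + card T"
proof -
  have "P ` {..d} \<subseteq> V" using P_V by auto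
  then have "card T = card V - card (P ` {..d})" "card (P ` {..d}) \<le> card V"
    unfolding T_def by (auto intro: card_Diff_subset card_mono)
  then show ?thesis using card_image[OF inj_P] by simp
qed

lemma notT: "x \<in> V \<Longrightarrow> x \<notin> T \<Longrightarrow> \<exists>i\<le>d. x = P i" by (auto simp: T_def)

lemma P_notT: "i \<le> d \<Longrightarrow> P i \<notin> T" by (auto simp: T_def)

lemma edge_T: "{x, y} \<in> E \<Longrightarrow> x \<in> T \<Longrightarrow> {x, y} \<in> N"
  by (auto simp: N_def PE_def T_def doubleton_eq_iff)

text \<open>The path is induced: \<open>a\<close> changes by at most one along an edge, and
  \<open>a (P i) = i\<close>. Consequently each edge in \<open>N\<close> has an end off the
  path.\<close>

lemma edge_PP: "i \<le> d \<Longrightarrow> j \<le> d \<Longrightarrow> {P i, P j} \<in> E \<Longrightarrow> {P i, P j} \<in> PE"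
proof (induction i j rule: linorder_wlog)
  case (le i j)
  then have "a (P j) \<le> a (P i) + 1" using gdist_edge_le P0 by blast
  then have "j \<le> i + 1" using le a_P by simp
  moreover have "i \<noteq> j" using le edge_pairD by blast
  ultimately have "j = Suc i" using le by simp
  then show ?case using le by (auto simp: PE_def)
qed (simp add: insert_commute)

lemma N_T: "{x, y} \<in> N \<Longrightarrow> x \<in> T \<or> y \<in> T"
  using edge_PP notT edge_pairD N_E unfolding N_def by (metis Diff_iff)

section \<open>Bad edges and the claims of off-path vertices\<close>

definition "bad r = {e \<in> N. \<exists>x\<in>e. r < eps x}"

lemma bad_sub: "bad r \<subseteq> N" by (auto simp: bad_def)

lemma finite_bad [simp]: "finite (bad r)" by (simp add: bad_def)

lemma sum_PE: "(\<Sum>e\<in>PE. prod eps e) = (\<Sum>i<d. eps (P i) * eps (P (Suc i)))"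
proof -
  have "i < d \<Longrightarrow> prod eps {P i, P (Suc i)} = eps (P i) * eps (P (Suc i))" for i
    using edge_pairD[OF edgeP] by simp
  then show ?thesis unfolding PE_def sum.reindex[OF inj_PE] by simp
qed

lemma sum_PE_ge: "path_sum d \<le> (\<Sum>e\<in>PE. prod eps e)"
  unfolding sum_PE path_sum_def by (intro sum_mono mult_le_mono eps_P) auto

lemma sigma2_split: "sigma2 V E = (\<Sum>e\<in>PE. prod eps e) + (\<Sum>e\<in>N. prod eps e)"
  unfolding sigma2_def N_def using sum.subset_diff[OF PE_sub finE, of "prod eps"] by simp

lemma sigma2_ge:
  assumes r: "2 * r \<le> d + 1"
  shows "path_sum d + r * r * card N + r * card (bad r) \<le> sigma2 V E"
proof -
  have "r * r * card N + r * card (bad r) = (\<Sum>e\<in>N. r * r + (if e \<in> bad r then r else 0))"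
    using bad_sub by (simp add: sum.distrib sum.If_cases Int_absorb1)
  also have "\<dots> \<le> (\<Sum>e\<in>N. prod eps e)"
  proof (rule sum_mono)
    fix e assume e: "e \<in> N"
    obtain x y where xy: "e = {x, y}" "x \<noteq> y" "x \<in> V" "y \<in> V" using edgeE[OF N_E[OF e]] .
    have ge: "r \<le> eps x" "r \<le> eps y" using xy eps_ge r by auto
    have "r * r + (if e \<in> bad r then r else 0) \<le> eps x * eps y"
    proof (cases "e \<in> bad r")
      case True
      then have "r < eps x \<or> r < eps y" by (auto simp: bad_def xy(1))
      then have "Suc r * r \<le> eps x * eps y \<or> r * Suc r \<le> eps x * eps y"
        using ge by (metis Suc_le_eq mult_le_mono)
      then show ?thesis using True by simp
    qed (use ge in \<open>simp add: mult_le_mono\<close>)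
    then show "r * r + (if e \<in> bad r then r else 0) \<le> prod eps e" using xy by simp
  qed
  finally show ?thesis using sigma2_split sum_PE_ge by simp
qed

text \<open>
  Every off-path vertex claims an edge to a neighbour that is closer to the nearer end of the path,
  and a vertex of eccentricity \<open>r\<close> equidistant from both ends claims one edge towards each end.
  No edge is claimed twice, because a double claim would create a vertex too close to both ends.
\<close>

definition "pa w = (SOME x. x \<in> V \<and> {x, w} \<in> E \<and> a w = Suc (a x))"
definition "pb w = (SOME x. x \<in> V \<and> {x, w} \<in> E \<and> b w = Suc (b x))"

lemma pa: "w \<in> T \<Longrightarrow> pa w \<in> V \<and> {pa w, w} \<in> E \<and> a w = Suc (a (pa w))"
  unfolding pa_def by (rule someI_ex) (metis P0 P_notT T_V gdist_pred le0)

lemma pb: "w \<in> T \<Longrightarrow> pb w \<in> V \<and> {pb w, w} \<in> E \<and> b w = Suc (b (pb w))"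
  unfolding pb_def by (rule someI_ex) (metis P_V P_notT T_V gdist_pred le_refl)

definition "fa w = {pa w, w}"
definition "fb w = {pb w, w}"

lemma fa_N: "w \<in> T \<Longrightarrow> fa w \<in> N" and fb_N: "w \<in> T \<Longrightarrow> fb w \<in> N"
  using pa pb edge_T unfolding fa_def fb_def by (metis insert_commute)+

text \<open>Two vertices with the same claim would each be the predecessor of the other, and
  \<open>a\<close> would drop in both directions.\<close>

lemma inj_fa: "inj_on fa T"
proof (rule inj_onI)
  fix u w assume "u \<in> T" "w \<in> T" "fa u = fa w"
  then show "u = w" using pa[of u] pa[of w] by (auto simp: fa_def doubleton_eq_iff)
qed

lemma inj_fb: "inj_on fb T"
proof (rule inj_onI)
  fix u w assume "u \<in> T" "w \<in> T" "fb u = fb w"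
  then show "u = w" using pb[of u] pb[of w] by (auto simp: fb_def doubleton_eq_iff)
qed

definition "S r = {w \<in> T. a w = b w \<and> eps w = r}"
text \<open>Ties go to \<open>Ta\<close>, which therefore contains \<open>S r\<close>. The second
  claim of a vertex in \<open>S r\<close>, towards \<open>P d\<close>, is counted by letting
  \<open>Tb \<union> S r\<close> claim on that side.\<close>

definition "Ta = {w \<in> T. a w \<le> b w}"
definition "Tb = {w \<in> T. b w < a w}"

lemma finS [simp]: "finite (S r)" by (simp add: S_def)

lemma S_T: "S r \<subseteq> T" by (auto simp: S_def)

lemma Tab: "Ta \<union> Tb = T" "Ta \<inter> Tb = {}" "S r \<subseteq> Ta" "finite Ta" "finite Tb" "S r \<inter> Tb = {}"
  by (auto simp: Ta_def Tb_def S_def)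

text \<open>If one vertex \<open>w\<close> made both claims on the same edge, its neighbour
  \<open>x\<close> would satisfy \<open>a x + b x = a w + b w - 2 <= 2 * r - 2 < d\<close>. If two
  vertices did, \<open>u\<close> would be one step nearer to \<open>P 0\<close> and one step farther
  from \<open>P d\<close> than \<open>w\<close>, which is incompatible with
  \<open>a w <= b w\<close> and \<open>b u <= a u\<close>.\<close>

lemma fa_ne_fb:
  assumes r: "2 * r < d + 2" and w: "w \<in> Ta" and u: "u \<in> Tb \<union> S r"
  shows "fa w \<noteq> fb u"
proof
  assume eq: "fa w = fb u"
  have T: "w \<in> T" "u \<in> T" using w u by (auto simp: Ta_def Tb_def S_def)
  note pw = pa[OF T(1)] and pu = pb[OF T(2)]
  from eq consider "w = u" "pa w = pb u" | "w = pb u" "u = pa w"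
    by (auto simp: fa_def fb_def doubleton_eq_iff)
  then show False
  proof cases
    case 1
    then have "eps w = r" "a w = b w" using w u by (auto simp: Ta_def Tb_def S_def)
    then have "a w + b w \<le> 2 * r" using a_le_eps[OF T_V[OF T(1)]] by simp
    then show False using pw pu 1 ab_ge[of "pa w"] r by simp
  next
    case 2
    then show False using pw pu w u by (auto simp: Ta_def Tb_def S_def)
  qed
qed

lemma claims_card:
  assumes "2 * r < d + 2" "A \<subseteq> Ta" "B \<subseteq> Tb \<union> S r"
  shows "card (fa ` A \<union> fb ` B) = card A + card B"
proof -
  have T: "A \<subseteq> T" "B \<subseteq> T" using assms by (auto simp: Ta_def Tb_def S_def)
  have "fa ` A \<inter> fb ` B = {}" using fa_ne_fb assms by blast
  then have "card (fa ` A \<union> fb ` B) = card (fa ` A) + card (fb ` B)"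
    using T finite_subset[OF _ finT] by (intro card_Un_disjoint) auto
  then show ?thesis using T inj_fa inj_fb by (simp add: card_image inj_on_subset)
qed

lemma card_Tab: "card Ta + card (Tb \<union> S r) = card T + card (S r)"
  using card_Un_disjoint[of Ta Tb] card_Un_disjoint[of Tb "S r"] Tab by (simp add: Int_commute)

lemma card_N_ge: assumes "2 * r < d + 2" shows "card T + card (S r) \<le> card N"
proof -
  have "fa ` Ta \<union> fb ` (Tb \<union> S r) \<subseteq> N" using fa_N fb_N Tab S_T by blast
  from card_mono[OF finN this] show ?thesis using claims_card[OF assms subset_refl subset_refl] card_Tab by simp
qed

text \<open>A step towards \<open>P 0\<close> is paid for at the other end:
  \<open>b (pa w) >= d - a (pa w) = d - a w + 1 > r\<close>.\<close>

lemma fa_bad_pa: "w \<in> T \<Longrightarrow> r + a w \<le> d \<Longrightarrow> fa w \<in> bad r"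
  using pa[of w] ab_ge[of "pa w"] b_le_eps[of "pa w"] fa_N[of w]
  by (auto simp: bad_def fa_def)

lemma fb_bad_pb: "w \<in> T \<Longrightarrow> r + b w \<le> d \<Longrightarrow> fb w \<in> bad r"
  using pb[of w] ab_ge[of "pb w"] a_le_eps[of "pb w"] fb_N[of w]
  by (auto simp: bad_def fb_def)

lemma f_bad_self: "w \<in> T \<Longrightarrow> r < eps w \<Longrightarrow> fa w \<in> bad r \<and> fb w \<in> bad r"
  using fa_N[of w] fb_N[of w] by (auto simp: bad_def fa_def fb_def)

text \<open>All claims together give \<open>t + |S r| <= card N\<close>, where
  \<open>t = card T\<close>; those of the vertices outside \<open>S r\<close> are bad and give
  \<open>t - |S r| <= card (bad r)\<close>. In the sum the unknown \<open>|S r|\<close>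
  cancels.\<close>

lemma bad_odd:
  assumes d: "d + 1 = 2 * r"
  shows "2 * card T \<le> card N + card (bad r)"
proof -
  have r: "2 * r < d + 2" "2 * r \<le> d + 1" using d by auto
  \<comment> \<open>If \<open>eps w = r\<close>, then \<open>a w <= b w <= r\<close>, and equality
    throughout would put \<open>w\<close> into \<open>S r\<close>. So \<open>a w <= r - 1\<close>,
    which is \<open>r + a w <= d\<close> because \<open>d = 2 * r - 1\<close>.\<close>
  have "fa w \<in> bad r" if "w \<in> Ta - S r" for w
  proof (cases "r < eps w")
    case False
    then have "r + a w \<le> d" using that eps_ge[OF T_V r(2), of w] a_le_eps[OF T_V, of w] b_le_eps[OF T_V, of w] d
      by (auto simp: Ta_def S_def)
    then show ?thesis using that fa_bad_pa by (auto simp: Ta_def)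
  qed (use that f_bad_self in \<open>auto simp: Ta_def\<close>)
  moreover have "fb w \<in> bad r" if "w \<in> Tb" for w
  proof (cases "r < eps w")
    case False
    then have "r + b w \<le> d" using that eps_ge[OF T_V r(2), of w] a_le_eps[OF T_V, of w] b_le_eps[OF T_V, of w] d
      by (auto simp: Tb_def)
    then show ?thesis using that fb_bad_pb by (auto simp: Tb_def)
  qed (use that f_bad_self in \<open>auto simp: Tb_def\<close>)
  ultimately have "fa ` (Ta - S r) \<union> fb ` Tb \<subseteq> bad r" by auto
  from card_mono[OF finite_bad this] have "card (Ta - S r) + card Tb \<le> card (bad r)"
    by (subst (asm) claims_card[OF r(1)]) auto
  moreover have "card (Ta - S r) + card (S r) = card Ta"
    using card_Diff_subset[of "S r" Ta] card_mono[of Ta "S r"] Tab by simp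
  moreover have "card Ta + card Tb = card T" using card_Un_disjoint[of Ta Tb] Tab by simp
  ultimately show ?thesis using card_N_ge[OF r(1)] by simp
qed

lemma in_S_even:
  assumes "d = 2 * r" "w \<in> T" "\<not> r < eps w" shows "w \<in> S r \<and> a w = r \<and> b w = r"
proof -
  have "a w = r" "b w = r" "eps w = r"
    using assms(1,3) ab_ge[OF T_V[OF assms(2)]] a_le_eps[OF T_V[OF assms(2)]] b_le_eps[OF T_V[OF assms(2)]]
    by linarith+
  then show ?thesis using assms(2) by (simp add: S_def)
qed

text \<open>An off-path vertex of eccentricity \<open>r\<close> has
  \<open>a w = b w = r = d - r\<close>, so its neighbours on both claimed edges already have
  eccentricity above \<open>r\<close>. No claim has to be discarded, unlike for odd
  \<open>d\<close>.\<close>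

lemma bad_even:
  assumes d: "d = 2 * r"
  shows "card T + card (S r) \<le> card (bad r)"
proof -
  have r: "2 * r < d + 2" using d by auto
  have "fa w \<in> bad r \<and> fb w \<in> bad r" if "w \<in> T" for w
    using that f_bad_self[of w r] fa_bad_pa[of w r] fb_bad_pb[of w r] in_S_even[OF d, of w] d by fastforce
  then have "fa ` Ta \<union> fb ` (Tb \<union> S r) \<subseteq> bad r" using Tab S_T by blast
  from card_mono[OF finite_bad this] show ?thesis
    using claims_card[OF r subset_refl subset_refl] card_Tab by simp
qed

text \<open>On the path only \<open>P (r - 1)\<close> and \<open>P r\<close> can have eccentricity
  \<open>r\<close>, which leaves \<open>card T + 2\<close> candidates for the ends of a good edge.
  One of the pairs is itself a path edge; this is the \<open>+ 1\<close>.\<close>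

lemma good_odd:
  assumes d: "d + 1 = 2 * r"
  shows "card N + 1 \<le> card (bad r) + (card T + 2 choose 2)"
proof -
  have r: "0 < r" "r < d + 1" using d by auto
  define Y where "Y = T \<union> {P (r - 1), P r}"
  define pe where "pe = {P (r - 1), P r}"
  have Pne: "P (r - 1) \<noteq> P r" using a_P[of r] a_P[of "r - 1"] r by force
  then have cY: "card Y = card T + 2" "finite Y" using P_notT[of r] P_notT[of "r - 1"] r
    unfolding Y_def by (subst card_Un_disjoint) auto
  have pe: "pe \<in> PE" using r by (auto simp: pe_def PE_def intro!: image_eqI[of _ _ "r - 1"])
  have inY: "x \<in> Y" if "x \<in> V" "eps x \<le> r" for x
  proof (cases "x \<in> T")
    case False
    then obtain i where i: "i \<le> d" "x = P i" using notT \<open>x \<in> V\<close> by blast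
    then have "max i (d - i) \<le> r" using eps_P[of i] that by simp
    then have "i = r - 1 \<or> i = r" using d by auto
    then show ?thesis using i by (auto simp: Y_def)
  qed (simp add: Y_def)
  have "N - bad r \<subseteq> {e. e \<subseteq> Y \<and> card e = 2} - {pe}"
  proof
    fix e assume e: "e \<in> N - bad r"
    then have "e \<noteq> pe" using pe by (auto simp: N_def)
    moreover have "e \<subseteq> V" "card e = 2" using e edgeD N_E by auto
    moreover have "\<forall>x\<in>e. eps x \<le> r" using e by (auto simp: bad_def not_less)
    ultimately show "e \<in> {e. e \<subseteq> Y \<and> card e = 2} - {pe}" using inY by auto
  qed
  then have "card (N - bad r) \<le> card ({e. e \<subseteq> Y \<and> card e = 2} - {pe})"
    using cY by (intro card_mono) auto
  also have "\<dots> = (card T + 2 choose 2) - 1"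
    using Pne cY by (subst card_Diff_singleton) (auto simp: pe_def Y_def n_subsets)
  finally have "card N - card (bad r) \<le> (card T + 2 choose 2) - 1"
    using card_Diff_subset[OF finite_bad bad_sub] by simp
  moreover have "0 < (card T + 2 choose 2)" by simp
  ultimately show ?thesis by linarith
qed

text \<open>The candidates are fewer than for odd \<open>d\<close>: an off-path vertex of
  eccentricity \<open>r\<close> must be equidistant from both ends, hence lies in
  \<open>S r\<close>, and the path offers only its middle vertex.\<close>

lemma good_even:
  assumes d: "d = 2 * r"
  shows "card N \<le> card (bad r) + (card (S r) + 1 choose 2)"
proof -
  define Y where "Y = insert (P r) (S r)"
  have "P r \<notin> S r" using subsetD[OF S_T] P_notT[of r] d by fastforce
  then have cY: "card Y = card (S r) + 1" "finite Y" by (simp_all add: Y_def)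
  have inY: "x \<in> Y" if "x \<in> V" "eps x \<le> r" for x
  proof (cases "x \<in> T")
    case False
    then obtain i where i: "i \<le> d" "x = P i" using notT \<open>x \<in> V\<close> by blast
    then have "max i (d - i) \<le> r" using eps_P[of i] that by simp
    then have "i = r" using d by auto
    then show ?thesis using i by (auto simp: Y_def)
  qed (use that in_S_even[OF d, of x] in \<open>simp add: Y_def\<close>)
  have "N - bad r \<subseteq> {e. e \<subseteq> Y \<and> card e = 2}"
  proof
    fix e assume e: "e \<in> N - bad r"
    then have "e \<subseteq> V" "card e = 2" using edgeD N_E by auto
    moreover have "\<forall>x\<in>e. eps x \<le> r" using e by (auto simp: bad_def not_less)
    ultimately show "e \<in> {e. e \<subseteq> Y \<and> card e = 2}" using inY by auto
  qed
  then have "card (N - bad r) \<le> card {e. e \<subseteq> Y \<and> card e = 2}"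
    using cY by (intro card_mono) auto
  then have "card (N - bad r) \<le> (card (S r) + 1 choose 2)" using cY by (simp add: n_subsets)
  then show ?thesis using card_Diff_subset[OF finite_bad bad_sub, of r] by simp
qed

lemma card_N_le: "card N \<le> (card T choose 2) + 3 * card T"
proof -
  \<comment> \<open>An off-path vertex sees at most three path vertices, otherwise the path would have a shortcut.\<close>
  define I where "I w = {i. i \<le> d \<and> {w, P i} \<in> E}" for w
  have finI: "finite (I w)" for w by (simp add: I_def)
  have cI: "card (I w) \<le> 3" for w
  proof (cases "I w = {}")
    case False
    define i0 where "i0 = Min (I w)"
    have i0: "i0 \<in> I w" "\<And>i. i \<in> I w \<Longrightarrow> i0 \<le> i" using False finI by (auto simp: i0_def)
    have "I w \<subseteq> {i0..i0 + 2}"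
    proof
      fix i assume i: "i \<in> I w"
      have "a w \<le> a (P i0) + 1" "a (P i) \<le> a w + 1"
        using i i0(1) gdist_edge_le[OF _ P0, of "P i0" w] gdist_edge_le[OF _ P0, of w "P i"]
        by (auto simp: I_def insert_commute)
      then show "i \<in> {i0..i0 + 2}" using i i0 a_P by (auto simp: I_def)
    qed
    from card_mono[OF _ this] show ?thesis by simp
  qed simp
  have "N \<subseteq> {e. e \<subseteq> T \<and> card e = 2} \<union> (\<Union>w\<in>T. (\<lambda>i. {w, P i}) ` I w)"
  proof
    fix e assume e: "e \<in> N"
    obtain x y where xy: "e = {x, y}" "x \<noteq> y" "x \<in> V" "y \<in> V" using edgeE[OF N_E[OF e]] .
    consider "x \<in> T" "y \<in> T" | "x \<in> T" "y \<notin> T" | "x \<notin> T" "y \<in> T" using N_T e xy by blast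
    then show "e \<in> {e. e \<subseteq> T \<and> card e = 2} \<union> (\<Union>w\<in>T. (\<lambda>i. {w, P i}) ` I w)"
    proof cases
      case 2
      then obtain i where "i \<le> d" "y = P i" using notT xy by blast
      then show ?thesis using 2 xy N_E[OF e] by (auto simp: I_def)
    next
      case 3
      then obtain i where "i \<le> d" "x = P i" using notT xy by blast
      then have "i \<in> I y" "e = {y, P i}" using xy N_E[OF e] by (auto simp: I_def insert_commute)
      then show ?thesis using 3 by blast
    qed (use xy in auto)
  qed
  then have "card N \<le> card ({e. e \<subseteq> T \<and> card e = 2} \<union> (\<Union>w\<in>T. (\<lambda>i. {w, P i}) ` I w))"
    using finI by (intro card_mono) auto
  also have "\<dots> \<le> card {e. e \<subseteq> T \<and> card e = 2} + (\<Sum>w\<in>T. card ((\<lambda>i. {w, P i}) ` I w))"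
    by (rule order_trans[OF card_Un_le]) (simp add: card_UN_le)
  also have "\<dots> \<le> (card T choose 2) + (\<Sum>w\<in>T. 3)"
    using cI card_image_le[OF finI] by (intro add_mono sum_mono) (auto simp: n_subsets intro: order_trans)
  finally show ?thesis by simp
qed

end

lemma diametral_exists:
  assumes "connected_graph V E" "diam V E = d"
  obtains P where "diametral V E P d"
proof -
  interpret conn_graph V E by (unfold_locales) fact
  obtain u where u: "u \<in> V" "ecc V E u = d" using diam_attained assms by auto
  obtain v where v: "v \<in> V" "gdist E u v = d" using ecc_attained[of u] u by auto
  have "(u, v) \<in> adj E ^^ d" using gdist_relpow[OF u(1) v(1)] v(2) by simp
  then obtain f where f: "f 0 = u" "f d = v" "\<forall>i<d. {f i, f (Suc i)} \<in> E"
    unfolding relpow_fun_conv by auto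
  have "diametral V E f d" by unfold_locales (use f u v assms in auto)
  then show ?thesis using that by blast
qed

section \<open>Even diameter: the least \<open>k\<close> and the exceptional case\<close>

context diametral begin

text \<open>If \<open>|S r| >= k\<close>, the claims suffice. Otherwise put
  \<open>j = k - 1 >= |S r|\<close>: minimality of \<open>k\<close> gives
  \<open>M > t + C(j,2) + 2 j\<close> for \<open>M = card N\<close> and \<open>t = card T\<close>,
  at most \<open>C(j + 1, 2) = C(j,2) + j\<close> of these edges are good, and more than
  \<open>t + j\<close> remain.\<close>

lemma bad_even_Least:
  assumes d: "d = 2 * r" and k: "k = (LEAST k. card N \<le> card T + (k choose 2) + 2 * k)"
  shows "card T + k \<le> card (bad r)"
proof (cases "k \<le> card (S r)")
  case True
  then show ?thesis using bad_even[OF d] by linarith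
next
  case False
  then obtain j where j: "k = Suc j" "card (S r) \<le> j" by (cases k) auto
  have "\<not> card N \<le> card T + (j choose 2) + 2 * j"
    using not_less_Least[of j "\<lambda>k. card N \<le> card T + (k choose 2) + 2 * k"] k j(1) by simp
  moreover have "(card (S r) + 1 choose 2) \<le> (Suc j choose 2)"
    using j by (intro binomial_right_mono) simp
  moreover have "(Suc j choose 2) = (j choose 2) + j" by (simp add: numeral_2_eq_2)
  ultimately show ?thesis using good_even[OF d] j by linarith
qed

text \<open>The general bound is \<open>path_sum d + 6 * card N\<close> here. A total below it plus
  3 leaves so little slack that the eccentricities on off-path edges and at the centre are nearly
  determined, and no such graph exists.\<close>

lemma sigma2_ge_exceptional:
  assumes d: "d = 4" and cN: "card N = card T + 1" and cT: "2 \<le> card T"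
  shows "path_sum d + 6 * card N + 3 \<le> sigma2 V E"
proof (rule ccontr)
  assume less: "\<not> path_sum d + 6 * card N + 3 \<le> sigma2 V E"
  have d2: "d = 2 * 2" using d by simp
  have ge2: "2 \<le> eps x" if "x \<in> V" for x using eps_ge[of x 2] d that by simp
  \<comment> \<open>If \<open>S 2\<close> is empty, there are no good edges off the path; if not,
    the claims alone give \<open>card T + 1 = card N\<close> bad edges.\<close>
  have "card N \<le> card (bad 2)"
    using bad_even[OF d2] good_even[OF d2] cN by (cases "card (S 2)") (auto simp: numeral_2_eq_2)
  then have bad: "bad 2 = N" by (intro card_seteq bad_sub) auto
  have S1: "card (S 2) \<le> 1" using bad_even[OF d2] bad cN by simp
  have prod6: "6 \<le> prod eps e" if e: "e \<in> N" for e
  proof -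
    obtain x y where xy: "e = {x, y}" "x \<noteq> y" "x \<in> V" "y \<in> V" using edgeE[OF N_E[OF e]] .
    have "e \<in> bad 2" using e bad by simp
    then have "2 < eps x \<or> 2 < eps y" by (auto simp: bad_def xy(1))
    moreover have "3 * 2 \<le> eps x * eps y" if "2 < eps x"
      using that ge2[OF xy(4)] by (intro mult_le_mono) auto
    moreover have "2 * 3 \<le> eps x * eps y" if "2 < eps y"
      using that ge2[OF xy(3)] by (intro mult_le_mono) auto
    ultimately show ?thesis using xy by auto
  qed
  have sumN: "6 * card N \<le> (\<Sum>e\<in>N. prod eps e)"
    using sum_mono[of N "\<lambda>_. 6" "prod eps"] prod6 by simp
  \<comment> \<open>Two ends of eccentricity at least 3 give a product of at least 9 instead of 6,
    which uses up the whole slack.\<close>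
  have small: "\<exists>x\<in>e. eps x = 2" if e: "e \<in> N" for e
  proof (rule ccontr)
    assume *: "\<not> (\<exists>x\<in>e. eps x = 2)"
    obtain x y where xy: "e = {x, y}" "x \<noteq> y" "x \<in> V" "y \<in> V" using edgeE[OF N_E[OF e]] .
    have "3 \<le> eps x" "3 \<le> eps y" using * xy ge2[of x] ge2[of y] by fastforce+
    then have "3 * 3 \<le> prod eps e" using xy mult_le_mono[of 3 "eps x" 3 "eps y"] by simp
    then have "(\<Sum>f\<in>N. 6 + (if f = e then 3 else 0)) \<le> (\<Sum>f\<in>N. prod eps f)"
      using prod6 by (intro sum_mono) auto
    then have "6 * card N + 3 \<le> (\<Sum>f\<in>N. prod eps f)" using e by (simp add: sum.distrib)
    then show False using less sigma2_split sum_PE_ge by linarith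
  qed
  \<comment> \<open>Otherwise the path edges contribute at least
    \<open>12 + 9 + 9 + 12 = 42\<close>, instead of 36.\<close>
  have epsP2: "eps (P 2) = 2"
  proof (rule ccontr)
    assume "eps (P 2) \<noteq> 2"
    then have e: "4 \<le> eps (P 0)" "3 \<le> eps (P 1)" "3 \<le> eps (P 2)" "3 \<le> eps (P 3)" "4 \<le> eps (P 4)"
      using eps_P[of 0] eps_P[of 1] eps_P[of 2] eps_P[of 3] eps_P[of 4] d by auto
    have "(\<Sum>i<d. eps (P i) * eps (P (Suc i))) =
        eps (P 0) * eps (P 1) + eps (P 1) * eps (P 2) + eps (P 2) * eps (P 3) + eps (P 3) * eps (P 4)"
      by (simp add: d eval_nat_numeral)
    moreover have "4 * 3 \<le> eps (P 0) * eps (P 1)" "3 * 3 \<le> eps (P 1) * eps (P 2)"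
      "3 * 3 \<le> eps (P 2) * eps (P 3)" "3 * 4 \<le> eps (P 3) * eps (P 4)"
      using mult_le_mono[OF e(1,2)] mult_le_mono[OF e(2,3)] mult_le_mono[OF e(3,4)] mult_le_mono[OF e(4,5)]
      by auto
    moreover have "path_sum d = 36" unfolding d path_sum_def by (simp add: eval_nat_numeral)
    ultimately show False using less sigma2_split sumN sum_PE by linarith
  qed
  have P2: "P 2 \<in> V" "P 2 \<notin> T" using P_V P_notT d by auto
  have center: "x = P 2 \<or> x \<in> S 2" if x: "x \<in> V" "eps x = 2" for x
  proof (cases "x \<in> T")
    case False
    then obtain i where i: "i \<le> d" "x = P i" using notT x by blast
    then have "max i (d - i) \<le> 2" using eps_P[of i] x by simp
    then have "i = 2" using d by auto
    then show ?thesis using i by simp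
  qed (use in_S_even[OF d2, of x] x in auto)
  show False
  proof (cases "S 2 = {}")
    \<comment> \<open>With \<open>P 2\<close> as the only vertex of eccentricity 2, every off-path
      edge joins \<open>P 2\<close> to a vertex of \<open>T\<close>, so there are at most
      \<open>card T\<close> of them.\<close>
    case True
    have "N \<subseteq> (\<lambda>y. {P 2, y}) ` T"
    proof
      fix e assume e: "e \<in> N"
      obtain x where x: "x \<in> e" "eps x = 2" using small[OF e] by blast
      then have "x = P 2" using center True edgeD[OF N_E[OF e]] by auto
      moreover obtain y where "e = {x, y}" using edgeE[OF N_E[OF e]] x by (metis doubleton_eq_iff insertE singletonD)
      ultimately show "e \<in> (\<lambda>y. {P 2, y}) ` T" using N_T e P2 by auto
    qed
    then show False using surj_card_le[OF finT] cN by fastforce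
  next
    case False
    then have "card (S 2) = 1" using S1 card_0_eq[OF finS, of 2] by linarith
    then obtain w where w: "S 2 = {w}" by (auto simp: card_1_singleton_iff)
    then have wS: "w \<in> T" "a w = b w" "eps w = 2" by (auto simp: S_def)
    then have aw: "a w = 2" "b w = 2" using in_S_even[OF d2, of w] by auto
    have wV: "w \<in> V" using wS T_V by blast
    have wP2: "w \<noteq> P 2" using wS P2 by blast
    have not_edge: "{w, P 2} \<notin> E"
    proof
      assume "{w, P 2} \<in> E"
      then have "{w, P 2} \<in> bad 2" using edge_T wS bad by blast
      then show False using wS epsP2 by (auto simp: bad_def)
    qed
    \<comment> \<open>If \<open>pa w\<close> were off the path, it would be adjacent to
      \<open>P 0\<close>, and that edge would have no end of eccentricity 2, contrary to
      \<open>small\<close>.\<close>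
    have "pa w = P 1"
    proof (cases "pa w \<in> T")
      case True
      have "a (pa w) = 1" using pa[OF wS(1)] aw by simp
      then have "{P 0, pa w} \<in> N" using True P0 T_V gdist_eq_1[of "P 0" "pa w"] edge_T by (metis insert_commute)
      then obtain x where "x \<in> {P 0, pa w}" "eps x = 2" using small by blast
      moreover have "3 \<le> eps (pa w)" using \<open>a (pa w) = 1\<close> ab_ge[of "pa w"] pa[OF wS(1)] b_le_eps[of "pa w"] d by simp
      moreover have "4 \<le> eps (P 0)" using eps_P[of 0] d by simp
      ultimately show ?thesis by auto
    next
      case False
      then obtain i where i: "i \<le> d" "pa w = P i" using notT pa[OF wS(1)] by blast
      then show ?thesis using a_P[of i] pa[OF wS(1)] aw by simp
    qed
    moreover have "pb w = P 3"
    proof (cases "pb w \<in> T")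
      case True
      have "b (pb w) = 1" using pb[OF wS(1)] aw by simp
      then have "{P d, pb w} \<in> N" using True P_V[of d] T_V gdist_eq_1[of "P d" "pb w"] edge_T by (metis insert_commute le_refl)
      then obtain x where "x \<in> {P d, pb w}" "eps x = 2" using small by blast
      moreover have "3 \<le> eps (pb w)" using \<open>b (pb w) = 1\<close> ab_ge[of "pb w"] pb[OF wS(1)] a_le_eps[of "pb w"] d by simp
      moreover have "4 \<le> eps (P d)" using eps_P[of d] d by simp
      ultimately show ?thesis by auto
    next
      case False
      then obtain i where i: "i \<le> d" "pb w = P i" using notT pb[OF wS(1)] by blast
      then have "d - i = 1" using b_P[of i] pb[OF wS(1)] aw by simp
      then have "i = 3" using d by simp
      then show ?thesis using i by simp
    qed
    ultimately have fw: "fa w = {P 1, w}" "fb w = {P 3, w}" by (simp_all add: fa_def fb_def)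
    have PT: "P 1 \<notin> T" "P 3 \<notin> T" using P_notT d by auto
    have P13: "P 1 \<noteq> P 3" using a_P[of 1] a_P[of 3] d by auto
    have nb: "y = w \<or> y = P 2" if z: "z \<in> T" "z \<noteq> w" "{z, y} \<in> E" for z y
    proof -
      obtain x where x: "x \<in> {z, y}" "eps x = 2" using small[OF edge_T[OF z(3,1)]] by blast
      then have "x \<in> V" using edge_pairD[OF z(3)] by auto
      then have "x = P 2 \<or> x = w" using center[of x] x(2) w by simp
      moreover have "z \<noteq> P 2" using z(1) P2 by auto
      ultimately show ?thesis using x(1) z(2) by auto
    qed
    have "fb w \<notin> fa ` T" using fw PT P13 unfolding fa_def by (auto simp: doubleton_eq_iff)
    then have "card (insert (fb w) (fa ` T)) = card N"
      using card_image[OF inj_fa] cN by simp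
    moreover have "insert (fb w) (fa ` T) \<subseteq> N" using fa_N fb_N wS by auto
    ultimately have N: "N = insert (fb w) (fa ` T)" by (metis card_subset_eq finN)
    \<comment> \<open>The claims exhaust \<open>N\<close>, so a vertex \<open>z \<noteq> w\<close> is a leaf at \<open>w\<close> or \<open>P 2\<close>, hence too far from the other one.\<close>
    have only: "y = pa z" if z: "z \<in> T" "z \<noteq> w" "{z, y} \<in> E" for z y
    proof -
      have "{z, y} \<in> insert (fb w) (fa ` T)" using edge_T[OF z(3,1)] unfolding N .
      moreover have "{z, y} \<noteq> fb w" "{z, y} \<noteq> fa w" using fw z PT by (auto simp: doubleton_eq_iff)
      ultimately obtain z' where z': "z' \<in> T" "z' \<noteq> w" "{z, y} = {pa z', z'}" by (auto simp: fa_def)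
      have "z' \<noteq> y" using nb[OF z] z' P2 by blast
      then show ?thesis using z' by (auto simp: doubleton_eq_iff)
    qed
    obtain z where z: "z \<in> T" "z \<noteq> w"
    proof -
      have "\<not> T \<subseteq> {w}" using cT card_mono[of "{w}" T] by auto
      then show ?thesis using that by blast
    qed
    have zV: "z \<in> V" "z \<noteq> P 2" using z P2 T_V by blast+
    have no: False if cc: "{x, y} = {w, P 2}" "pa z = x" for x y
    proof -
      have xy: "x \<in> V" "y \<in> V" "y \<noteq> z" "eps y = 2" "{y, x} \<notin> E" "x \<noteq> y"
        using cc wV P2 zV z wS epsP2 not_edge wP2 by (auto simp: doubleton_eq_iff insert_commute)
      obtain x' where x': "x' \<in> V" "{x', z} \<in> E" "gdist E y z = Suc (gdist E y x')"
        using gdist_pred[OF xy(2) zV(1) xy(3)] .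
      have "x' = x" using only[OF z, of x'] x' cc(2) by (simp add: insert_commute)
      moreover have "gdist E y z \<le> 2" using gdist_le_ecc[OF xy(2) zV(1)] xy by simp
      ultimately have "gdist E y x \<le> 1" using x' by simp
      then show False using gdist_eq_0[OF xy(2,1)] gdist_eq_1[OF xy(2,1)] xy by (cases "gdist E y x") auto
    qed
    have "pa z = w \<or> pa z = P 2" using nb[OF z, of "pa z"] pa[OF z(1)] by (simp add: insert_commute)
    then show False using no[of w "P 2"] no[of "P 2" w] by (auto simp: insert_commute)
  qed
qed

end

section \<open>Graphs attaining the bounds\<close>

text \<open>Unlike \<open>gdist E u v <= k\<close>, this asserts that a walk exists, so it is
  meaningful before connectedness has been established.\<close>

definition near :: "'a set set \<Rightarrow> nat \<Rightarrow> 'a \<Rightarrow> 'a \<Rightarrow> bool" where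
  "near E k u v \<longleftrightarrow> (\<exists>j\<le>k. (u, v) \<in> adj E ^^ j)"

lemma near_refl [simp]: "near E k u u"
  unfolding near_def by (intro exI[of _ 0]) simp

lemma near_edge: "{u, v} \<in> E \<Longrightarrow> near E 1 u v"
  unfolding near_def by (intro exI[of _ 1]) simp

lemma near_trans: "near E j u v \<Longrightarrow> near E k v w \<Longrightarrow> near E (j + k) u w"
  unfolding near_def by (metis add_mono relcompI relpow_add)

lemma near_sym: "near E k u v \<Longrightarrow> near E k v u"
  unfolding near_def using relpow_adj_sym by metis

lemma near_mono: "near E j u v \<Longrightarrow> j \<le> k \<Longrightarrow> near E k u v"
  unfolding near_def using order_trans by blast

text \<open>Verifies a guessed eccentricity function \<open>e\<close>: short walks bound it from
  above and also give connectedness, and one witness per vertex bounds it from below.\<close>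

lemma ecc_eqI:
  assumes "simple_graph V E" "V \<noteq> {}"
    and near: "\<And>u v. u \<in> V \<Longrightarrow> v \<in> V \<Longrightarrow> near E (e u) u v"
    and far: "\<And>u. u \<in> V \<Longrightarrow> \<exists>v\<in>V. \<forall>k. (u, v) \<in> adj E ^^ k \<longrightarrow> e u \<le> k"
  shows "connected_graph V E" "\<And>u. u \<in> V \<Longrightarrow> ecc V E u = e u"
proof -
  show con: "connected_graph V E"
    unfolding connected_graph_iff using assms(1,2) near unfolding near_def by blast
  interpret conn_graph V E by unfold_locales (fact con)
  fix u assume u: "u \<in> V"
  obtain v where v: "v \<in> V" "\<forall>k. (u, v) \<in> adj E ^^ k \<longrightarrow> e u \<le> k" using far[OF u] by blast
  then have "e u \<le> gdist E u v" using gdist_relpow[OF u v(1)] by blast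
  also have "\<dots> \<le> ecc V E u" using gdist_le_ecc u v by blast
  finally have "e u \<le> ecc V E u" .
  moreover obtain v' where "v' \<in> V" "gdist E u v' = ecc V E u" using ecc_attained by blast
  moreover have "gdist E u v' \<le> e u" using near[OF u \<open>v' \<in> V\<close>] gdist_le unfolding near_def
    by (metis order_trans)
  ultimately show "ecc V E u = e u" by simp
qed

text \<open>
  All extremal graphs of diameter at least 3 are a path \<open>0, \<dots>, d\<close> whose extra vertices are joined to
  the central vertex \<open>c\<close> (those in \<open>C\<close>), to \<open>c - 1\<close> (\<open>L\<close>), to \<open>c + 1\<close> (\<open>R\<close>) and to each other (\<open>F\<close>).
  The functions \<open>g0\<close> and \<open>gd\<close> below are the distances to the two ends of the path.
\<close>

locale spider =
  fixes n d c :: nat and C L R :: "nat set" and F :: "nat set set"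
  assumes d3: "3 \<le> d" and c: "1 \<le> c" "Suc c \<le> d" and dn: "d < n"
    and CT: "C \<subseteq> {d<..<n}" and LT: "L \<subseteq> {d<..<n}" and RT: "R \<subseteq> {d<..<n}"
    and FT: "F \<subseteq> {e. e \<subseteq> {d<..<n} \<and> card e = 2}"
    and cover: "\<And>w. d < w \<Longrightarrow> w < n \<Longrightarrow> w \<notin> C \<Longrightarrow> w \<in> L \<and> w \<in> R"
    and short: "C = {d<..<n} \<or> {d<..<n} \<subseteq> L \<inter> R \<or> 3 \<le> c"
begin

definition "edges = (\<lambda>i. {i, Suc i}) ` {..<d} \<union> (\<lambda>w. {c, w}) ` C \<union> (\<lambda>w. {c - 1, w}) ` L
  \<union> (\<lambda>w. {Suc c, w}) ` R \<union> F"

definition "g0 u = (if u \<le> d then u else if u \<in> L then c else c + 1)"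
definition "gd u = (if u \<le> d then d - u else if u \<in> R then d - c else d - c + 1)"
definition "e u = max (g0 u) (gd u)"

lemma fin: "finite C" "finite L" "finite R" "finite F"
  using CT LT RT finite_subset by (blast, blast, blast) (rule finite_subset[OF FT], simp)

lemma FD: "{x, y} \<in> F \<Longrightarrow> d < x \<and> x < n \<and> d < y \<and> y < n" using FT by auto

text \<open>The weight \<open>h\<close> is arbitrary because the number of edges (\<open>h\<close>
  constantly 1) and the index (\<open>h\<close> the product of eccentricities) are both read off
  from it.\<close>

lemma sum_edges:
  fixes h :: "nat set \<Rightarrow> nat"
  shows "sum h edges = (\<Sum>i<d. h {i, Suc i}) + (\<Sum>w\<in>C. h {c, w}) + (\<Sum>w\<in>L. h {c - 1, w})
    + (\<Sum>w\<in>R. h {Suc c, w}) + sum h F"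
proof -
  have inj: "inj_on (\<lambda>i. {i, Suc i}) {..<d}" "inj_on (\<lambda>w. {c, w}) C" "inj_on (\<lambda>w. {c - 1, w}) L"
    "inj_on (\<lambda>w. {Suc c, w}) R"
    by (auto simp: inj_on_def doubleton_eq_iff)
  have gt: "d < w" if "w \<in> C \<or> w \<in> L \<or> w \<in> R \<or> w \<in> \<Union> F" for w
    using that CT LT RT FT by fastforce
  have le: "c \<le> d" "c - 1 \<le> d" "Suc c \<le> d" "c - 1 \<noteq> c" using c by auto
  let ?A = "(\<lambda>i. {i, Suc i}) ` {..<d}" and ?B = "(\<lambda>w. {c, w}) ` C"
    and ?C = "(\<lambda>w. {c - 1, w}) ` L" and ?D = "(\<lambda>w. {Suc c, w}) ` R"
  have 1: "?A \<inter> ?B = {}"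
    using gt le by (fastforce simp: doubleton_eq_iff)
  have 2: "(?A \<union> ?B) \<inter> ?C = {}"
    using gt le by (fastforce simp: doubleton_eq_iff)
  have 3: "(?A \<union> ?B \<union> ?C) \<inter> ?D = {}"
    using gt le by (fastforce simp: doubleton_eq_iff)
  have "\<exists>x\<in>f. x \<le> d" if "f \<in> ?A \<union> ?B \<union> ?C \<union> ?D" for f
    using that le by fastforce
  then have 4: "(?A \<union> ?B \<union> ?C \<union> ?D) \<inter> F = {}" using gt by (meson Union_iff disjoint_iff not_le)
  have "sum h edges = sum h ?A + sum h ?B + sum h ?C + sum h ?D + sum h F"
    unfolding edges_def using 1 2 3 4 fin by (simp add: sum.union_disjoint)
  then show ?thesis unfolding sum.reindex[OF inj(1)] sum.reindex[OF inj(2)] sum.reindex[OF inj(3)]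
      sum.reindex[OF inj(4)] comp_def .
qed

lemma card_edges: "card edges = d + card C + card L + card R + card F"
  using sum_edges[of "\<lambda>_. 1"] by simp

lemma simple: "simple_graph {..<n} edges"
proof -
  have "f \<subseteq> {..<n} \<and> card f = 2" if "f \<in> edges" for f
    using that CT LT RT FT c dn unfolding edges_def by (fastforce simp: card_insert_if)
  then show ?thesis unfolding simple_graph_def by simp
qed

lemma near_path: "i \<le> d \<Longrightarrow> j \<le> d \<Longrightarrow> near edges ((i - j) + (j - i)) i j"
proof (induction i j rule: linorder_wlog)
  case (le i j)
  have "near edges (j - i) i j" using le(1,3)
  proof (induction j rule: dec_induct)
    case (step j)
    then have "{j, Suc j} \<in> edges" by (auto simp: edges_def)
    from near_trans[OF _ near_edge[OF this]] have "near edges (j - i + 1) i (Suc j)" using step by simp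
    then show ?case using step by (simp add: Suc_diff_le)
  qed simp
  then show ?case using le by simp
qed (metis add.commute near_sym)

lemma near_C: "w \<in> C \<Longrightarrow> near edges 1 c w" and near_L: "w \<in> L \<Longrightarrow> near edges 1 (c - 1) w"
  and near_R: "w \<in> R \<Longrightarrow> near edges 1 (Suc c) w"
  by (rule near_edge, simp add: edges_def)+

lemma near_PC: "i \<le> d \<Longrightarrow> w \<in> C \<Longrightarrow> near edges ((i - c) + (c - i) + 1) i w"
  using near_trans[OF near_path near_C] c by simp

lemma near_PL: "i \<le> d \<Longrightarrow> w \<in> L \<Longrightarrow> near edges ((i - (c - 1)) + (c - 1 - i) + 1) i w"
  using near_trans[OF near_path near_L] c by simp

lemma near_PR: "i \<le> d \<Longrightarrow> w \<in> R \<Longrightarrow> near edges ((i - Suc c) + (Suc c - i) + 1) i w"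
  using near_trans[OF near_path near_R] c by simp

lemma near_ecc:
  assumes u: "u < n" and v: "v < n"
  shows "near edges (e u) u v"
proof -
  have ge: "c \<le> e x" "d - c \<le> e x" "2 \<le> e x" if "d < x" for x
    using that c d3 by (auto simp: e_def g0_def gd_def)
  consider "u \<le> d" "v \<le> d" | "u \<le> d" "d < v" "v \<in> C" | "u \<le> d" "d < v" "v \<in> L" "v \<in> R"
    | "d < u" "v \<le> d" | "d < u" "d < v" using cover u v by (meson not_le)
  then show ?thesis
  proof cases
    case 1
    then show ?thesis by (intro near_mono[OF near_path]) (auto simp: e_def g0_def gd_def)
  next
    case 2
    then show ?thesis using c by (intro near_mono[OF near_PC]) (auto simp: e_def g0_def gd_def)
  next
    case 3
    show ?thesis
    proof (cases "u < c")
      case True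
      then show ?thesis using c 3 by (intro near_mono[OF near_PL]) (auto simp: e_def g0_def gd_def)
    next
      case False
      then show ?thesis using c 3 d3 by (intro near_mono[OF near_PR]) (auto simp: e_def g0_def gd_def)
    qed
  next
    case 4
    have L: ?thesis if "u \<in> L" "v < c"
      using 4 c that ge[OF 4(1)] by (intro near_sym[of edges _ v u] near_mono[OF near_PL]) auto
    have R: ?thesis if "u \<in> R" "c < v"
      using 4 c that ge[OF 4(1)] by (intro near_sym[of edges _ v u] near_mono[OF near_PR]) auto
    have cc: ?thesis if "u \<in> L" "v = c"
      using 4 c that ge[OF 4(1)] by (intro near_sym[of edges _ v u] near_mono[OF near_PL]) auto
    have C: ?thesis if "u \<in> C"
    proof (cases "v < c \<and> u \<in> L \<or> c < v \<and> u \<in> R")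
      case False
      then show ?thesis
        using 4 c that by (intro near_sym[of edges _ v u] near_mono[OF near_PC]) (auto simp: e_def g0_def gd_def)
    qed (use L R in auto)
    show ?thesis using L R cc C cover[of u] 4 u by (meson linorder_neqE_nat)
  next
    \<comment> \<open>Two extra vertices with a common neighbour on the path are at distance at most
      2. One joined to \<open>c\<close> and one joined to \<open>c - 1\<close> may be at distance 3;
      \<open>short\<close> ensures that this is needed only when
      \<open>3 <= c <= e u\<close>.\<close>
    case 5
    have C: ?thesis if "u \<in> C" "v \<in> C"
      using near_trans[OF near_sym[OF near_C] near_C] that near_mono ge[OF 5(1)] by fastforce
    have L: ?thesis if "u \<in> L" "v \<in> L"
      using near_trans[OF near_sym[OF near_L] near_L] that near_mono ge[OF 5(1)] by fastforce
    have pc: "near edges 1 (c - 1) c" using near_path[of "c - 1" c] c by simp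
    have e3: "3 \<le> e u" if "c \<ge> 3" using ge[OF 5(1)] that by linarith
    have CL: ?thesis if "u \<in> C" "v \<in> L" "3 \<le> c"
      using near_trans[OF near_trans[OF near_sym[OF near_C] near_sym[OF pc]] near_L] that near_mono e3
      by fastforce
    have LC: ?thesis if "u \<in> L" "v \<in> C" "3 \<le> c"
      using near_trans[OF near_trans[OF near_sym[OF near_L] pc] near_C] that near_mono e3
      by fastforce
    show ?thesis using short
    proof (elim disjE)
      assume "C = {d<..<n}" then show ?thesis using 5 u v C by auto
    next
      assume "{d<..<n} \<subseteq> L \<inter> R"
      moreover have "u \<in> {d<..<n}" "v \<in> {d<..<n}" using 5 u v by auto
      ultimately have "u \<in> L" "v \<in> L" by blast+
      then show ?thesis by (rule L)
    next
      assume "3 \<le> c" then show ?thesis using 5 u v C L CL LC cover by blast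
    qed
  qed
qed

text \<open>Edges between extra vertices do no harm: there \<open>g0\<close> takes only the values
  \<open>c\<close> and \<open>c + 1\<close>, and \<open>gd\<close> only \<open>d - c\<close> and
  \<open>d - c + 1\<close>.\<close>

lemma lipschitz: assumes "{x, y} \<in> edges" shows "g0 y \<le> g0 x + 1" "gd y \<le> gd x + 1"
proof -
  have gt: "d < w" if "w \<in> C \<or> w \<in> L \<or> w \<in> R" for w
    using that CT LT RT by fastforce
  have "(x \<le> d \<and> y \<le> d \<and> (y = Suc x \<or> x = Suc y)) \<or>
    (x = c \<and> d < y \<or> y = c \<and> d < x) \<or> (x = c - 1 \<and> y \<in> L \<or> y = c - 1 \<and> x \<in> L) \<or>
    (x = Suc c \<and> y \<in> R \<or> y = Suc c \<and> x \<in> R) \<or> (d < x \<and> d < y)"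
  proof -
    from assms consider i where "i < d" "{x, y} = {i, Suc i}" | w where "w \<in> C" "{x, y} = {c, w}"
      | w where "w \<in> L" "{x, y} = {c - 1, w}" | w where "w \<in> R" "{x, y} = {Suc c, w}" | "{x, y} \<in> F"
      unfolding edges_def by (elim UnE imageE) (auto simp only: lessThan_iff)
    then show ?thesis
    proof cases
      case 1
      then have "x = i \<and> y = Suc i \<or> x = Suc i \<and> y = i" by (simp only: doubleton_eq_iff)
      with 1(1) have "x \<le> d \<and> y \<le> d \<and> (y = Suc x \<or> x = Suc y)" by (elim disjE) simp_all
      then show ?thesis by blast
    next
      case 2
      then have "x = c \<and> y = w \<or> x = w \<and> y = c" by (simp only: doubleton_eq_iff)
      then show ?thesis using 2 gt[of w] by blast
    next
      case 3
      then have "x = c - 1 \<and> y = w \<or> x = w \<and> y = c - 1" by (simp only: doubleton_eq_iff)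
      then show ?thesis using 3 by blast
    next
      case 4
      then have "x = Suc c \<and> y = w \<or> x = w \<and> y = Suc c" by (simp only: doubleton_eq_iff)
      then show ?thesis using 4 by blast
    next
      case 5
      then show ?thesis using FD by blast
    qed
  qed
  then show "g0 y \<le> g0 x + 1" "gd y \<le> gd x + 1"
    using c gt[of x] gt[of y] unfolding g0_def gd_def by (auto simp: not_le split: if_splits)
qed

lemma far: "\<exists>v\<in>{..<n}. \<forall>k. (u, v) \<in> adj edges ^^ k \<longrightarrow> e u \<le> k"
proof -
  have "g0 u \<le> k" if "(u, 0) \<in> adj edges ^^ k" for k
    using relpow_adj_lipschitz[OF relpow_adj_sym[OF that], of "\<lambda>x. int (g0 x)"] lipschitz
    by (fastforce simp: g0_def[of 0])
  moreover have "gd u \<le> k" if "(u, d) \<in> adj edges ^^ k" for k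
    using relpow_adj_lipschitz[OF relpow_adj_sym[OF that], of "\<lambda>x. int (gd x)"] lipschitz
    by (fastforce simp: gd_def[of d])
  ultimately show ?thesis
    using dn by (cases "gd u \<le> g0 u") (auto simp: e_def max_def intro: bexI[of _ 0] bexI[of _ d])
qed

lemma connected: "connected_graph {..<n} edges"
  by (rule ecc_eqI(1)[OF simple _ _ far]) (use dn near_ecc in auto)

lemma ecc: "u < n \<Longrightarrow> ecc {..<n} edges u = e u"
  by (rule ecc_eqI(2)[OF simple _ _ far]) (use dn near_ecc in auto)

lemma diam: "diam {..<n} edges = d"
proof -
  have "e u \<le> d" for u using c by (auto simp: e_def g0_def gd_def)
  moreover have "e 0 = d" by (simp add: e_def g0_def gd_def)
  ultimately have "Max (e ` {..<n}) = d" using dn by (intro Max_eqI) (auto intro!: image_eqI[of _ _ 0])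
  then show ?thesis unfolding diam_def using ecc by (simp cong: image_cong_simp)
qed

lemma params: "m = d + card C + card L + card R + card F \<Longrightarrow> cgraph_params {..<n} edges n m d"
  unfolding cgraph_params_def using connected diam card_edges by simp

lemma e_path: "i \<le> d \<Longrightarrow> e i = max i (d - i)"
  by (simp add: e_def g0_def gd_def)

lemma sigma2_eq: "sigma2 {..<n} edges = path_sum d + (\<Sum>w\<in>C. e c * e w) + (\<Sum>w\<in>L. e (c - 1) * e w)
    + (\<Sum>w\<in>R. e (Suc c) * e w) + (\<Sum>f\<in>F. prod e f)"
proof -
  have "sigma2 {..<n} edges = (\<Sum>f\<in>edges. prod e f)"
    unfolding sigma2_def
  proof (intro sum.cong prod.cong refl)
    fix f x assume "f \<in> edges" "x \<in> f"
    then have "x < n" using simple unfolding simple_graph_def by auto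
    then show "ecc {..<n} edges x = e x" by (rule ecc)
  qed
  also have "\<dots> = path_sum d + (\<Sum>w\<in>C. e c * e w) + (\<Sum>w\<in>L. e (c - 1) * e w)
    + (\<Sum>w\<in>R. e (Suc c) * e w) + (\<Sum>f\<in>F. prod e f)"
  proof -
    have path: "(\<Sum>i<d. prod e {i, Suc i}) = path_sum d"
      unfolding path_sum_def by (intro sum.cong refl) (simp add: e_path)
    have "w \<noteq> c \<and> w \<noteq> c - 1 \<and> w \<noteq> Suc c" if "w \<in> C \<or> w \<in> L \<or> w \<in> R" for w
    proof -
      have "d < w" using that CT LT RT by fastforce
      then show ?thesis using c by auto
    qed
    moreover have prod_pair: "prod e {x, w} = e x * e w" if "w \<noteq> x" for x w using that by auto
    ultimately have "w \<in> C \<Longrightarrow> prod e {c, w} = e c * e w" "w \<in> L \<Longrightarrow> prod e {c - 1, w} = e (c - 1) * e w"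
      "w \<in> R \<Longrightarrow> prod e {Suc c, w} = e (Suc c) * e w" for w by (metis prod_pair)+
    with path show ?thesis unfolding sum_edges by simp
  qed
  finally show ?thesis .
qed

end

text \<open>All \<open>t\<close> extra vertices are joined to \<open>s\<close>, of which
  \<open>q\<close> also to \<open>s + 1\<close>, and \<open>l\<close> of those also to
  \<open>s - 1\<close>; the \<open>f\<close> further edges lie among the \<open>q\<close>. The bad
  edges are the spokes of the \<open>p\<close> vertices joined only to \<open>s\<close> and the
  \<open>l\<close> edges at \<open>s - 1\<close>, whose other end has eccentricity
  \<open>s + 2\<close>.\<close>

lemma odd_extremal:
  assumes d: "d = 2 * s + 1" and s: "1 \<le> s" and n: "n = d + 1 + t"
    and pq: "p + q = t" and l: "l \<le> q" and f: "f \<le> (q choose 2)"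
  shows "\<exists>(H :: nat set) F. cgraph_params H F n (d + (t + q + l + f)) d \<and>
    sigma2 H F = path_sum d + (s + 1) * (s + 1) * (t + q + l + f) + (s + 1) * (p + l)"
proof -
  let ?T = "{d<..<n}"
  have T: "card ?T = t" using n by simp
  obtain R where R: "R \<subseteq> ?T" "card R = q" "finite R"
    using obtain_subset_with_card_n[of q ?T] T pq by auto
  obtain L where L: "L \<subseteq> R" "card L = l" "finite L"
    using obtain_subset_with_card_n[of l R] R l by auto
  have "card {e. e \<subseteq> R \<and> card e = 2} = q choose 2" using R n_subsets by blast
  then obtain F where F: "F \<subseteq> {e. e \<subseteq> R \<and> card e = 2}" "card F = f" "finite F"
    using obtain_subset_with_card_n[of f "{e. e \<subseteq> R \<and> card e = 2}"] f by auto
  interpret spider n d s ?T L R F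
    by unfold_locales (use d s n R L F in auto)
  have e: "e s = s + 1" "e (Suc s) = s + 1" "e (s - 1) = s + 2"
    "\<And>w. d < w \<Longrightarrow> e w = (if w \<in> R then s + 1 else s + 2)"
    unfolding e_def g0_def gd_def using d s by auto
  have eR: "e w = s + 1" if "w \<in> R" for w using that R e(4)[of w] by auto
  have "(\<Sum>w\<in>?T. e s * e w) = (\<Sum>w\<in>?T. (s + 1) * (s + 1) + (if w \<in> ?T - R then s + 1 else 0))"
    by (rule sum.cong) (auto simp: e algebra_simps)
  also have "\<dots> = (s + 1) * (s + 1) * t + (s + 1) * p"
  proof -
    have "card (?T - R) = p" using R T pq by (simp add: card_Diff_subset)
    moreover have "?T \<inter> (?T - R) = ?T - R" by blast
    ultimately show ?thesis using T by (simp only: sum.distrib sum_constant sum.inter_restrict[symmetric] finite_greaterThanLessThan) (simp add: algebra_simps)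
  qed
  finally have "sigma2 {..<n} edges =
      path_sum d + ((s + 1) * (s + 1) * t + (s + 1) * p) + (s + 2) * (s + 1) * l
      + (s + 1) * (s + 1) * q + (s + 1) * (s + 1) * f"
  proof -
    assume C: "(\<Sum>w\<in>?T. e s * e w) = (s + 1) * (s + 1) * t + (s + 1) * p"
    have "(\<Sum>w\<in>L. e (s - 1) * e w) = (\<Sum>w\<in>L. (s + 2) * (s + 1))"
      using L eR e by (intro sum.cong) auto
    moreover have "(\<Sum>w\<in>R. e (Suc s) * e w) = (\<Sum>w\<in>R. (s + 1) * (s + 1))"
      using eR e by (intro sum.cong) auto
    moreover have "(\<Sum>x\<in>F. prod e x) = (\<Sum>x\<in>F. (s + 1) * (s + 1))"
    proof (rule sum.cong)
      fix x assume "x \<in> F"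
      then have x: "x \<subseteq> R" "card x = 2" using F by auto
      then have "prod e x = (\<Prod>y\<in>x. s + 1)" using eR by (intro prod.cong) auto
      then show "prod e x = (s + 1) * (s + 1)" using x by (simp add: power2_eq_square)
    qed simp
    ultimately show ?thesis unfolding sigma2_eq C by (simp only: sum_constant L R F mult.commute) simp
  qed
  then have "sigma2 {..<n} edges = path_sum d + (s + 1) * (s + 1) * (t + q + l + f) + (s + 1) * (p + l)"
    by (simp add: algebra_simps)
  moreover have "cgraph_params {..<n} edges n (d + (t + q + l + f)) d"
    by (rule params) (simp add: n R L F)
  ultimately show ?thesis by blast
qed

text \<open>Common computation for all families of even diameter: an extra vertex has eccentricity
  \<open>s\<close> exactly if it is joined to both neighbours of the centre, which is membership in
  \<open>Q\<close>.\<close>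

lemma even_spider:
  assumes d: "d = 2 * s" and s: "2 \<le> s" and n: "n = d + 1 + t" and Q: "Q \<subseteq> {d<..<n}"
    and C: "C \<subseteq> {d<..<n}" "{d<..<n} - C \<subseteq> Q" "C = {d<..<n} \<or> {d<..<n} \<subseteq> Q \<or> 3 \<le> s"
    and F: "F \<subseteq> {f. f \<subseteq> {d<..<n} \<and> card f = 2}"
  defines "e \<equiv> \<lambda>w. if w \<in> Q then s else s + 1"
  shows "\<exists>(H :: nat set) E. cgraph_params H E n (d + (card C + 2 * card Q + card F)) d \<and>
    sigma2 H E = path_sum d + s * s * card C + s * card (C - Q) + 2 * s * (s + 1) * card Q + (\<Sum>f\<in>F. prod e f)"
proof -
  interpret S: spider n d s C Q Q F
    by unfold_locales (use assms in auto)
  have ee: "S.e s = s" "S.e (Suc s) = s + 1" "S.e (s - 1) = s + 1"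
    "\<And>w. d < w \<Longrightarrow> S.e w = e w"
    unfolding S.e_def S.g0_def S.gd_def e_def using d s by auto
  have "(\<Sum>w\<in>C. S.e s * S.e w) = (\<Sum>w\<in>C. s * s + (if w \<in> C - Q then s else 0))"
    using C(1) by (intro sum.cong) (auto simp: ee e_def algebra_simps)
  also have "\<dots> = s * s * card C + s * card (C - Q)"
  proof -
    have "(\<Sum>w\<in>C. if w \<in> C - Q then s else 0) = (\<Sum>w\<in>C \<inter> (C - Q). s)"
      by (rule sum.inter_restrict[symmetric]) (rule S.fin)
    moreover have "C \<inter> (C - Q) = C - Q" by blast
    ultimately show ?thesis by (simp only: sum.distrib sum_constant) simp
  qed
  finally have sC: "(\<Sum>w\<in>C. S.e s * S.e w) = \<dots>" .
  have eQ: "S.e w = s" if "w \<in> Q" for w using that Q ee(4)[of w] by (auto simp: e_def)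
  have sQ: "(\<Sum>w\<in>Q. S.e (s - 1) * S.e w) = (s + 1) * s * card Q"
    "(\<Sum>w\<in>Q. S.e (Suc s) * S.e w) = (s + 1) * s * card Q"
    using eQ ee by simp_all
  have sF: "(\<Sum>f\<in>F. prod S.e f) = (\<Sum>f\<in>F. prod e f)"
  proof (intro sum.cong prod.cong refl)
    fix f w assume "f \<in> F" "w \<in> f"
    then have "d < w" using subsetD[OF F] by fastforce
    then show "S.e w = e w" by (rule ee(4))
  qed
  have "sigma2 {..<n} S.edges = path_sum d + s * s * card C + s * card (C - Q)
      + 2 * s * (s + 1) * card Q + (\<Sum>f\<in>F. prod e f)"
    unfolding S.sigma2_eq sC sQ sF by (simp add: algebra_simps)
  moreover have "cgraph_params {..<n} S.edges n (d + (card C + 2 * card Q + card F)) d"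
    by (rule S.params) simp
  ultimately show ?thesis by blast
qed

text \<open>Every extra vertex is joined to the centre, and the edges among extra vertices stay
  inside \<open>Q\<close>. The bad edges are \<open>t - q\<close> spokes and \<open>2 * q\<close>
  side edges, \<open>t + q\<close> in all.\<close>

lemma even_extremal:
  assumes d: "d = 2 * s" and s: "2 \<le> s" and n: "n = d + 1 + t" and q: "q \<le> t" and f: "f \<le> (q choose 2)"
  shows "\<exists>(H :: nat set) E. cgraph_params H E n (d + (t + 2 * q + f)) d \<and>
    sigma2 H E = path_sum d + s * s * (t + 2 * q + f) + s * (t + q)"
proof -
  let ?T = "{d<..<n}"
  have T: "card ?T = t" using n by simp
  obtain Q where Q: "Q \<subseteq> ?T" "card Q = q" "finite Q"
    using obtain_subset_with_card_n[of q ?T] T q by auto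
  have "card {e. e \<subseteq> Q \<and> card e = 2} = q choose 2" using Q n_subsets by blast
  then obtain F where F: "F \<subseteq> {e. e \<subseteq> Q \<and> card e = 2}" "card F = f" "finite F"
    using obtain_subset_with_card_n[of f "{e. e \<subseteq> Q \<and> card e = 2}"] f by auto
  have sF: "(\<Sum>f\<in>F. \<Prod>w\<in>f. if w \<in> Q then s else s + 1) = s * s * f"
  proof -
    have "(\<Prod>w\<in>x. if w \<in> Q then s else s + 1) = s * s" if "x \<in> F" for x
    proof -
      have x: "x \<subseteq> Q" "card x = 2" using that F by auto
      then have "(\<Prod>w\<in>x. if w \<in> Q then s else s + 1) = (\<Prod>w\<in>x. s)" by (intro prod.cong) auto
      then show ?thesis using x by (simp add: power2_eq_square)
    qed
    then show ?thesis using F by simp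
  qed
  have TQ: "card (?T - Q) = t - q" using Q T by (simp add: card_Diff_subset)
  have FT: "F \<subseteq> {f. f \<subseteq> ?T \<and> card f = 2}" using F Q by auto
  have eq: "path_sum d + s * s * t + s * (t - q) + 2 * s * (s + 1) * q + s * s * f
      = path_sum d + s * s * (t + 2 * q + f) + s * (t + q)"
  proof -
    obtain p where "t = q + p" using q le_Suc_ex by blast
    then show ?thesis by (simp add: algebra_simps)
  qed
  show ?thesis using even_spider[OF d s n Q(1) subset_refl _ _ FT]
    unfolding sF TQ T Q(2) F(2) eq by simp
qed

text \<open>\<open>even_extremal\<close> cannot produce \<open>t + 3\<close> off-path edges. One
  vertex in \<open>Q\<close> gives \<open>t + 2\<close>, and the last edge joins it to a vertex of
  eccentricity \<open>s + 1\<close>.\<close>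

lemma even_extremal_two:
  assumes d: "d = 2 * s" and s: "2 \<le> s" and n: "n = d + 1 + t" and t: "2 \<le> t"
  shows "\<exists>(H :: nat set) E. cgraph_params H E n (d + (t + 3)) d \<and>
    sigma2 H E = path_sum d + s * s * (t + 3) + s * (t + 2)"
proof -
  let ?T = "{d<..<n}" and ?Q = "{Suc d}" and ?F = "{{Suc d, Suc (Suc d)}}"
  have T: "card ?T = t" "card (?T - ?Q) = t - 1" using n t by simp_all
  have QF: "?Q \<subseteq> ?T" "?F \<subseteq> {f. f \<subseteq> ?T \<and> card f = 2}" using n t by auto
  have eq: "path_sum d + s * s * t + s * (t - 1) + 2 * s * (s + 1) * 1 + s * (s + 1)
      = path_sum d + s * s * (t + 3) + s * (t + 2)"
  proof -
    obtain p where "t = 2 + p" using t le_Suc_ex by blast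
    then show ?thesis by (simp add: algebra_simps)
  qed
  have c: "card ?Q = 1" "card ?F = 1" "t + 2 * 1 + 1 = t + 3" by simp_all
  have sF: "(\<Sum>f\<in>?F. \<Prod>w\<in>f. if w \<in> ?Q then s else s + 1) = s * (s + 1)" by simp
  show ?thesis using even_spider[OF d s n QF(1) subset_refl _ _ QF(2)] unfolding T c sF eq by blast
qed

text \<open>The single vertex of \<open>Q\<close> gives up its spoke. It then has distance 3 from
  the leaves at the centre, so either there are no leaves or \<open>s >= 3\<close>.\<close>

lemma even_extremal_one:
  assumes d: "d = 2 * s" and s: "2 \<le> s" and n: "n = d + 1 + t" and t: "1 \<le> t" "t = 1 \<or> 3 \<le> s"
  shows "\<exists>(H :: nat set) E. cgraph_params H E n (d + (t + 1)) d \<and>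
    sigma2 H E = path_sum d + s * s * (t + 1) + s * (t + 1)"
proof -
  let ?T = "{d<..<n}" and ?Q = "{Suc d}"
  have T: "card (?T - ?Q) = t - 1" "?T - ?Q - ?Q = ?T - ?Q" using n t by auto
  have Q: "?Q \<subseteq> ?T" "?T - ?Q \<subseteq> ?T" "?T - (?T - ?Q) \<subseteq> ?Q"
    "?T - ?Q = ?T \<or> ?T \<subseteq> ?Q \<or> 3 \<le> s" using n t by auto
  have eq: "path_sum d + s * s * (t - 1) + s * (t - 1) + 2 * s * (s + 1) * 1 + 0
      = path_sum d + s * s * (t + 1) + s * (t + 1)"
  proof -
    obtain p where "t = 1 + p" using t le_Suc_ex by blast
    then show ?thesis by (simp add: algebra_simps)
  qed
  have c: "t - 1 + 2 * 1 + 0 = t + 1" "card ?Q = 1" using t by simp_all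
  show ?thesis using even_spider[OF d s n Q empty_subsetI]
    unfolding T(2) T(1) c(2) sum.empty card.empty c(1) eq by blast
qed

text \<open>All extra vertices have eccentricity \<open>s + 1\<close>, and one edge joins two of
  them; its product is \<open>(s + 1) * (s + 1)\<close> instead of \<open>s * (s + 1)\<close>. For
  \<open>s = 2\<close> this is the loss of 3.\<close>

lemma even_extremal_exceptional:
  assumes d: "d = 2 * s" and s: "2 \<le> s" and n: "n = d + 1 + t" and t: "2 \<le> t"
  shows "\<exists>(H :: nat set) E. cgraph_params H E n (d + (t + 1)) d \<and>
    sigma2 H E = path_sum d + s * s * t + s * t + (s + 1) * (s + 1)"
proof -
  let ?T = "{d<..<n}" and ?F = "{{Suc d, Suc (Suc d)}}"
  have T: "card ?T = t" using n t by simp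
  have F: "?F \<subseteq> {f. f \<subseteq> ?T \<and> card f = 2}" using n t by auto
  show ?thesis using even_spider[OF d s n empty_subsetI subset_refl _ _ F] T by simp
qed

section \<open>Diameter at most two: graphs determined by their dominating vertices\<close>

lemma join_sums:
  assumes V: "finite V" "D \<subseteq> V" and E': "E' \<subseteq> {f. f \<subseteq> V - D \<and> card f = 2}"
    and E: "E = {f. f \<subseteq> V \<and> card f = 2 \<and> f \<inter> D \<noteq> {}} \<union> E'"
    and e: "\<And>x. x \<in> D \<Longrightarrow> e x = (1::nat)" "\<And>x. x \<in> V - D \<Longrightarrow> e x = 2"
  shows "card E = (card D choose 2) + card D * (card V - card D) + card E'"
    and "(\<Sum>f\<in>E. prod e f) = (card D choose 2) + 2 * card D * (card V - card D) + 4 * card E'"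
proof -
  let ?A = "{f. f \<subseteq> D \<and> card f = 2}" and ?B = "(\<lambda>(x, y). {x, y}) ` (D \<times> (V - D))"
  have fin: "finite D" "finite ?A" "finite ?B" "finite E'"
    using V finite_subset[OF V(2,1)] finite_subset[OF E'] by auto
  have split: "E = ?A \<union> ?B \<union> E'"
  proof -
    have "{f. f \<subseteq> V \<and> card f = 2 \<and> f \<inter> D \<noteq> {}} = ?A \<union> ?B"
    proof (intro equalityI subsetI)
      fix f assume "f \<in> {f. f \<subseteq> V \<and> card f = 2 \<and> f \<inter> D \<noteq> {}}"
      then have f: "f \<subseteq> V" "card f = 2" "f \<inter> D \<noteq> {}" by auto
      then obtain x where x: "x \<in> f" "x \<in> D" by blast
      then obtain y where y: "f = {x, y}" "x \<noteq> y" using f(2) by (auto simp: card_2_iff)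
      show "f \<in> ?A \<union> ?B" using x y f by (cases "y \<in> D") auto
    next
      fix f assume "f \<in> ?A \<union> ?B"
      then show "f \<in> {f. f \<subseteq> V \<and> card f = 2 \<and> f \<inter> D \<noteq> {}}"
      proof
        assume "f \<in> ?A"
        then show ?thesis using V(2) by (auto simp: Int_absorb2)
      next
        assume "f \<in> ?B"
        then obtain x y where "x \<in> D" "y \<in> V - D" "f = {x, y}" by auto
        moreover then have "x \<noteq> y" by blast
        ultimately show ?thesis using V(2) by auto
      qed
    qed
    then show ?thesis using E by simp
  qed
  have AB: "?A \<inter> ?B = {}" by auto
  have C: "(?A \<union> ?B) \<inter> E' = {}"
  proof -
    have meet: "f \<inter> D \<noteq> {}" if "f \<in> ?A \<union> ?B" for f using that by (auto simp: Int_absorb2)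
    have avoid: "f \<inter> D = {}" if "f \<in> E'" for f using that E' by auto
    show ?thesis
    proof (rule equals0I)
      fix f assume f: "f \<in> (?A \<union> ?B) \<inter> E'"
      from meet[OF IntD1[OF f]] avoid[OF IntD2[OF f]] show False by simp
    qed
  qed
  have inj: "inj_on (\<lambda>(x, y). {x, y}) (D \<times> (V - D))"
    by (auto simp: inj_on_def doubleton_eq_iff)
  have cards: "card ?A = card D choose 2" "card ?B = card D * (card V - card D)"
    using n_subsets[OF fin(1)] card_image[OF inj] card_Diff_subset[OF fin(1) V(2)]
    by (simp_all add: card_cartesian_product)
  show "card E = (card D choose 2) + card D * (card V - card D) + card E'"
    unfolding split using AB C fin cards by (simp add: card_Un_disjoint)
  have "(\<Sum>f\<in>?A. prod e f) = (\<Sum>f\<in>?A. 1)"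
    using e(1) by (intro sum.cong refl prod.neutral) auto
  moreover have "(\<Sum>f\<in>?B. prod e f) = (\<Sum>f\<in>?B. 2)"
  proof (rule sum.cong)
    fix f assume "f \<in> ?B"
    then obtain x y where f: "x \<in> D" "y \<in> V - D" "f = {x, y}" by auto
    then have "x \<noteq> y" by blast
    then show "prod e f = 2" using f e by simp
  qed simp
  moreover have "(\<Sum>f\<in>E'. prod e f) = (\<Sum>f\<in>E'. 4)"
  proof (rule sum.cong)
    fix f assume "f \<in> E'"
    then have f: "f \<subseteq> V - D" "card f = 2" using E' by auto
    then have "prod e f = (\<Prod>x\<in>f. 2)" using e(2) by (intro prod.cong) auto
    then show "prod e f = 4" using f by simp
  qed simp
  ultimately show "(\<Sum>f\<in>E. prod e f) = (card D choose 2) + 2 * card D * (card V - card D) + 4 * card E'"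
    unfolding split using AB C fin cards by (simp add: sum.union_disjoint)
qed

text \<open>There are \<open>k\<close> dominating vertices and \<open>f\<close> edges among the
  others. As \<open>f < n - k - 1\<close>, these edges cannot make another vertex dominating. The
  complete graph, \<open>k = n\<close>, is included because it serves diameter 1.\<close>

lemma join_exists:
  assumes k: "1 \<le> k" "k \<le> n" "2 \<le> n" and f: "k < n \<Longrightarrow> f + k + 1 < n" "k = n \<Longrightarrow> f = 0"
  shows "\<exists>(H :: nat set) F. cgraph_params H F n ((k choose 2) + k * (n - k) + f) (if k = n then 1 else 2) \<and>
    sigma2 H F = (k choose 2) + 2 * k * (n - k) + 4 * f"
proof -
  let ?V = "{..<n}" and ?D = "{..<k}"
  let ?P = "{f. f \<subseteq> ?V - ?D \<and> card f = 2}"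
  have cV: "card (?V - ?D) = n - k" using k by (subst card_Diff_subset) auto
  have "f \<le> (n - k choose 2)"
  proof (cases "k = n")
    case False
    then obtain p where "n - k = Suc p" using k by (metis diff_is_0_eq le_antisym not0_implies_Suc)
    then show ?thesis using f(1) False k by (simp add: numeral_2_eq_2)
  qed (use f in simp)
  moreover have "card ?P = (n - k choose 2)" using n_subsets[of "?V - ?D" 2] cV by simp
  ultimately obtain E' where E': "E' \<subseteq> ?P" "card E' = f" "finite E'"
    using obtain_subset_with_card_n[of f ?P] by auto
  define F where "F = {f. f \<subseteq> ?V \<and> card f = 2 \<and> f \<inter> ?D \<noteq> {}} \<union> E'"
  define e where "e x = (if x < k then 1 else 2 :: nat)" for x
  have sums: "card F = (k choose 2) + k * (n - k) + f"
    "(\<Sum>f\<in>F. prod e f) = (k choose 2) + 2 * k * (n - k) + 4 * f"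
    using join_sums[of ?V ?D E' F e] k E' F_def by (auto simp: e_def)
  have simple: "simple_graph ?V F" 
  proof -
    have "f \<subseteq> ?V \<and> card f = 2" if "f \<in> F" for f using that E'(1) unfolding F_def by blast
    then show ?thesis unfolding simple_graph_def by simp
  qed
  have V0: "?V \<noteq> {}" using k by (auto simp: lessThan_empty_iff)
  have dom: "near F 1 u v" if "u < k" "v < n" for u v
  proof (cases "u = v")
    case False
    then show ?thesis using that k by (intro near_edge) (auto simp: F_def)
  qed simp
  have near: "near F (e u) u v" if "u \<in> ?V" "v \<in> ?V" for u v
  proof (cases "u < k")
    case False
    have "near F (1 + 1) u v"
      using that k by (intro near_trans[OF near_sym[OF dom[of 0 u]] dom[of 0 v]]) auto
    then show ?thesis using False by (simp add: e_def numeral_2_eq_2)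
  qed (use dom[of u v] that in \<open>simp add: e_def\<close>)
  have far: "\<exists>v\<in>?V. \<forall>j. (u, v) \<in> adj F ^^ j \<longrightarrow> e u \<le> j" if u: "u \<in> ?V" for u
  proof (cases "u < k")
    case True
    have "\<exists>v<n. v \<noteq> u" using k(3) by (intro exI[of _ "if u = 0 then 1 else 0"]) auto
    then obtain v where v: "v < n" "v \<noteq> u" by blast
    have "1 \<le> j" if "(u, v) \<in> adj F ^^ j" for j using that v by (cases j) auto
    then show ?thesis using v True by (auto simp: e_def)
  next
    case False
    \<comment> \<open>Otherwise \<open>E'\<close> would contain the \<open>n - k - 1\<close> edges
      from \<open>u\<close> to the other non-dominating vertices, more than its \<open>f\<close>
      edges.\<close>
    have "\<exists>v\<in>?V - ?D - {u}. {u, v} \<notin> F"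
    proof (rule ccontr)
      assume *: "\<not> ?thesis"
      have "{u, v} \<in> E'" if v: "v \<in> ?V - ?D - {u}" for v
        using * v False unfolding F_def by fastforce
      then have "(\<lambda>v. {u, v}) ` (?V - ?D - {u}) \<subseteq> E'" by blast
      from card_mono[OF E'(3) this] have "card (?V - ?D - {u}) \<le> f"
        using E'(2) by (subst (asm) card_image) (auto simp: inj_on_def doubleton_eq_iff)
      moreover have "card (?V - ?D - {u}) = n - k - 1" using cV u False by (simp add: card_Diff_singleton)
      ultimately show False using f(1) u False by simp
    qed
    then obtain v where "v \<in> ?V - ?D - {u}" "{u, v} \<notin> F" by blast
    then have v: "v < n" "v \<noteq> u" "{u, v} \<notin> F" by auto
    have "2 \<le> j" if "(u, v) \<in> adj F ^^ j" for j
    proof -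
      have "j \<noteq> 0" using that v by (intro notI) simp
      moreover have "j \<noteq> 1" using that v by (intro notI) simp
      ultimately show ?thesis by simp
    qed
    then show ?thesis using v False by (auto simp: e_def)
  qed
  note ecc = ecc_eqI[OF simple V0 near far]
  have "diam ?V F = Max (e ` ?V)" unfolding diam_def using ecc(2) by (metis (no_types, lifting) image_cong)
  also have "\<dots> = (if k = n then 1 else 2)"
    using k by (intro Max_eqI) (auto simp: e_def intro!: image_eqI[of _ _ "n - 1"])
  finally have "cgraph_params ?V F n ((k choose 2) + k * (n - k) + f) (if k = n then 1 else 2)"
    unfolding cgraph_params_def using ecc(1) sums(1) by simp
  moreover have "sigma2 ?V F = (\<Sum>f\<in>F. prod e f)"
    unfolding sigma2_def
  proof (intro sum.cong prod.cong refl)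
    fix f x assume "f \<in> F" "x \<in> f"
    then show "ecc ?V F x = e x" using simple ecc(2) unfolding simple_graph_def by blast
  qed
  ultimately show ?thesis using sums(2) by metis
qed

text \<open>Eccentricity 1 means dominating, so every pair meeting the set of such vertices is an
  edge and all other vertices have eccentricity 2. Here \<open>j\<close> counts the dominating
  vertices and \<open>x\<close> the edges avoiding them.\<close>

lemma (in diametral) diameter_le_2:
  assumes d: "1 \<le> d" "d \<le> 2"
  obtains j x where "j \<le> card V" "card E = (j choose 2) + j * (card V - j) + x"
    "sigma2 V E = (j choose 2) + 2 * j * (card V - j) + 4 * x"
    "d = 1 \<Longrightarrow> j = card V \<and> x = 0"
    "d = 2 \<Longrightarrow> card E < (card V choose 2)"
proof -
  define D where "D = {x \<in> V. eps x = 1}"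
  define E' where "E' = {f \<in> E. f \<inter> D = {}}"
  have D: "D \<subseteq> V" "finite D" using finite_subset[OF _ finV] by (auto simp: D_def)
  have E'sub: "E' \<subseteq> {f. f \<subseteq> V - D \<and> card f = 2}" using edgeD by (auto simp: E'_def)
  have e12: "eps x = 1 \<or> eps x = 2" if "x \<in> V" for x
    using eps_ge[OF that, of 1] eps_le[OF that] d by auto
  have full: "{x, y} \<in> E" if "x \<in> D" "y \<in> V" "x \<noteq> y" for x y
  proof -
    have "x \<in> V" "eps x = 1" using that by (auto simp: D_def)
    then have "gdist E x y \<le> 1" "gdist E x y \<noteq> 0"
      using gdist_le_ecc[of x y] gdist_eq_0[of x y] that by auto
    then have "gdist E x y = 1" by linarith
    then show ?thesis using gdist_eq_1[of x y] \<open>x \<in> V\<close> that by simp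
  qed
  have E_eq: "E = {f. f \<subseteq> V \<and> card f = 2 \<and> f \<inter> D \<noteq> {}} \<union> E'"
  proof (intro equalityI subsetI)
    fix f assume "f \<in> {f. f \<subseteq> V \<and> card f = 2 \<and> f \<inter> D \<noteq> {}} \<union> E'"
    then show "f \<in> E"
    proof
      assume "f \<in> {f. f \<subseteq> V \<and> card f = 2 \<and> f \<inter> D \<noteq> {}}"
      then obtain x where x: "x \<in> f" "x \<in> D" "f \<subseteq> V" "card f = 2" by blast
      then obtain y where y: "f = {x, y}" "x \<noteq> y" by (auto simp: card_2_iff)
      then show ?thesis using full[of x y] x by simp
    qed (simp add: E'_def)
  qed (use edgeD in \<open>auto simp: E'_def\<close>)
  have e: "\<And>x. x \<in> D \<Longrightarrow> eps x = 1" "\<And>x. x \<in> V - D \<Longrightarrow> eps x = 2"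
    using e12 by (auto simp: D_def)
  have sums: "card E = (card D choose 2) + card D * (card V - card D) + card E'"
    "(\<Sum>f\<in>E. prod eps f) = (card D choose 2) + 2 * card D * (card V - card D) + 4 * card E'"
    using join_sums[OF finV D(1) E'sub E_eq, of eps] e by auto
  have "card D = card V \<and> card E' = 0" if d1: "d = 1"
  proof -
    have "D = V" using e12 eps_le d1 by (force simp: D_def)
    then have "E' = {}" using E'sub by auto
    then show ?thesis using \<open>D = V\<close> by simp
  qed
  moreover have "card E < (card V choose 2)" if d2: "d = 2"
  proof -
    have "{P 0, P 2} \<notin> E" using distP gdist_edge[of "P 0" "P 2"] d2 by auto
    moreover have "P 0 \<noteq> P 2" using a_P[of 0] a_P[of 2] d2 by auto
    ultimately have "E \<subset> {f. f \<subseteq> V \<and> card f = 2}"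
      using edgeD P_V[of 0] P_V[of 2] d2 by (auto intro!: psubsetI)
    then have "card E < card {f. f \<subseteq> V \<and> card f = 2}" by (intro psubset_card_mono) auto
    then show ?thesis using n_subsets[OF finV] by simp
  qed
  ultimately show ?thesis
    using that[of "card D" "card E'"] card_mono[OF finV D(1)] sums unfolding sigma2_def by blast
qed

section \<open>The bounds\<close>

lemma choose_two_Suc: "Suc k choose 2 = (k choose 2) + k"
  by (simp add: numeral_2_eq_2)

lemma odd_bound_eq:
  assumes "d = 2 * s + 1" "m = d + M"
  shows "(7 * real d ^ 3 - real d + 6) / 12 + (real m - real d) * (real d + 1)^2 / 4
    = real (path_sum d + (s + 1) * (s + 1) * M)"
proof -
  have "real d = 2 * real s + 1" "real m - real d = M" using assms by simp_all
  then have "(7 * real d ^ 3 - real d + 6) / 12 + (real m - real d) * (real d + 1)^2 / 4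
    = (7 * (2 * real s + 1) ^ 3 - (2 * real s + 1) + 6) / 12 + real M * (2 * real s + 1 + 1)^2 / 4"
    by simp
  also have "\<dots> = (3 * real (path_sum d)) / 3 + (real s + 1) * (real s + 1) * M"
    unfolding assms(1) path_sum_odd by (simp add: field_simps power2_eq_square power3_eq_cube)
  finally show ?thesis by (simp add: algebra_simps)
qed

lemma even_bound_eq:
  assumes "d = 2 * s" "m = d + M" "n = d + 1 + t"
  shows "(7 * real d ^ 3 - 4 * real d) / 12 + (real m - real d) * (real d)^2 / 4
      + (real n - 1 - real d + real k) * real d / 2
    = real (path_sum d + s * s * M + s * (t + k))"
proof -
  have "real d = 2 * real s" "real m - real d = M" "real n - 1 - real d = t" using assms by simp_all
  then have "(7 * real d ^ 3 - 4 * real d) / 12 + (real m - real d) * (real d)^2 / 4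
      + (real n - 1 - real d + real k) * real d / 2
    = (7 * (2 * real s) ^ 3 - 4 * (2 * real s)) / 12 + real M * (2 * real s)^2 / 4
      + (real t + real k) * (2 * real s) / 2"
    by simp
  also have "\<dots> = (3 * real (path_sum d)) / 3 + real s * s * M + s * (real t + k)"
    unfolding assms(1) path_sum_even by (simp add: field_simps power2_eq_square power3_eq_cube)
  finally show ?thesis by (simp add: algebra_simps)
qed

lemma mono_upto:
  fixes f :: "nat \<Rightarrow> nat"
  assumes "\<And>k. k < n \<Longrightarrow> f k \<le> f (Suc k)" "j \<le> k" "k \<le> n"
  shows "f j \<le> f k"
  using assms(2,3)
proof (induction k rule: dec_induct)
  case (step k)
  then show ?case using assms(1)[of k] by (auto intro: order_trans)
qed simp

context diametral begin

lemma odd_interior: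
  assumes n: "card V = n" and m: "card E = m" and odd: "odd d"
    and lo: "2 * int n - 2 - int d \<le> int m" and hi: "m \<le> ((n - d) choose 2) + n - 1"
    and B: "B = (7 * real d ^ 3 - real d + 6) / 12 + (real m - real d) * (real d + 1)^2 / 4"
  shows "real (sigma2 V E) \<ge> B \<and>
    (\<exists>(H :: nat set) F. cgraph_params H F n m d \<and> real (sigma2 H F) = B)"
proof -
  obtain s where s: "d = 2 * s + 1" using odd by (elim oddE)
  let ?t = "card T" and ?M = "card N"
  have n': "n = d + 1 + ?t" and m': "m = d + ?M" using card_T card_N n m by auto
  have B': "B = real (path_sum d + (s + 1) * (s + 1) * ?M)" unfolding B by (rule odd_bound_eq[OF s m'])
  have r: "2 * (s + 1) \<le> d + 1" using s by simp
  have "path_sum d + (s + 1) * (s + 1) * ?M \<le> sigma2 V E"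
    using sigma2_ge[OF r] by linarith
  moreover have "\<exists>(H :: nat set) F. cgraph_params H F n m d \<and>
    sigma2 H F = path_sum d + (s + 1) * (s + 1) * ?M"
  proof (cases "s = 0")
    \<comment> \<open>Diameter 1 is not reached by the path construction, which has
      \<open>d >= 3\<close>; the graph is complete.\<close>
    case True
    then have d1: "d = 1" using s by simp
    obtain j x where "j \<le> card V" "card E = (j choose 2) + j * (card V - j) + x" "j = card V \<and> x = 0"
      using diameter_le_2 d1 by auto
    then have mc: "m = (n choose 2)" using n m by simp
    have "path_sum d = 1" unfolding d1 path_sum_def by simp
    then have "path_sum d + (s + 1) * (s + 1) * ?M = m" using True d1 m' by simp
    then show ?thesis using join_exists[of n n 0] n' d1 mc by auto
  next
    case False
    have ge: "2 * ?t \<le> ?M" using lo n' m' by linarith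
    moreover have "n - d = Suc ?t" using n' by simp
    then have "?M - 2 * ?t \<le> (?t choose 2)" using hi n' m' by (simp add: choose_two_Suc)
    moreover have "?t + ?t + 0 + (?M - 2 * ?t) = ?M" using ge by simp
    \<comment> \<open>Each extra vertex is joined to both middle vertices, and the remaining
      \<open>M - 2 t\<close> edges go among the extra vertices, so no off-path edge is bad.\<close>
    ultimately show ?thesis
      using odd_extremal[OF s _ n', of 0 ?t 0 "?M - 2 * ?t"] False unfolding m' by simp
  qed
  ultimately show ?thesis unfolding B' by (metis of_nat_le_iff)
qed

lemma odd_boundary:
  assumes n: "card V = n" and m: "card E = m" and odd: "odd d"
    and k: "1 \<le> k" "int k \<le> int n - int d - 1"
    and km: "int m = 2 * int n - 2 - int d - int k \<or> m = ((n - d) choose 2) + n - 1 + k"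
    and B: "B = (7 * real d ^ 3 - real d + 6) / 12 + (real m - real d) * (real d + 1)^2 / 4
                + real k * (real d + 1) / 2"
  shows "real (sigma2 V E) \<ge> B \<and>
    (\<exists>(H :: nat set) F. cgraph_params H F n m d \<and> real (sigma2 H F) = B)"
proof -
  obtain s where s: "d = 2 * s + 1" using odd by (elim oddE)
  let ?t = "card T" and ?M = "card N"
  have n': "n = d + 1 + ?t" and m': "m = d + ?M" using card_T card_N n m by auto
  have "real k * (real d + 1) / 2 = real ((s + 1) * k)" using s by (simp add: field_simps)
  then have B': "B = real (path_sum d + (s + 1) * (s + 1) * ?M + (s + 1) * k)"
    unfolding B odd_bound_eq[OF s m'] by simp
  have kt: "k \<le> ?t" using k n' by linarith
  have nd: "n - d = Suc ?t" using n' by simp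
  have km': "?M = 2 * ?t - k \<or> ?M = (?t choose 2) + 2 * ?t + k"
    using km kt unfolding nd choose_two_Suc unfolding n' m' by auto
  have d2: "d + 1 = 2 * (s + 1)" using s by simp
  have "?t + 2 choose 2 = (?t choose 2) + 2 * ?t + 1"
    using choose_two_Suc[of "Suc ?t"] choose_two_Suc[of ?t] by simp
  then have "k \<le> card (bad (s + 1))"
    using km' kt bad_odd[OF d2] good_odd[OF d2] by auto
  then have "(s + 1) * k \<le> (s + 1) * card (bad (s + 1))" by (rule mult_le_mono2)
  then have "path_sum d + (s + 1) * (s + 1) * ?M + (s + 1) * k \<le> sigma2 V E"
    using sigma2_ge[OF eq_refl[OF d2[symmetric]]] by linarith
  moreover have "\<exists>(H :: nat set) F. cgraph_params H F n m d \<and>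
    sigma2 H F = path_sum d + (s + 1) * (s + 1) * ?M + (s + 1) * k"
  proof (cases "s = 0")
    \<comment> \<open>A complete graph has exactly \<open>C(t,2) + 2 t\<close> off-path edges, which
      neither alternative allows when \<open>1 <= k <= t\<close>.\<close>
    case True
    then have d1: "d = 1" using s by simp
    obtain j x where "j \<le> card V" "card E = (j choose 2) + j * (card V - j) + x" "j = card V \<and> x = 0"
      using diameter_le_2 d1 by auto
    then have "m = (n choose 2)" using n m by simp
    also have "\<dots> = (?t choose 2) + 2 * ?t + 1"
      using n' d1 choose_two_Suc[of "Suc ?t"] choose_two_Suc[of ?t] by simp
    finally have "?M = (?t choose 2) + 2 * ?t" using m' d1 by simp
    then show ?thesis using km' k kt by auto
  next
    case False
    from km' show ?thesis
    proof
      assume M: "?M = 2 * ?t - k"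
      \<comment> \<open>With too few edges, \<open>k\<close> extra vertices keep only one
        edge.\<close>
      have "?t + (?t - k) + 0 + 0 = ?M" using kt M by simp
      then show ?thesis
        using odd_extremal[OF s _ n', of k "?t - k" 0 0] False kt unfolding m' by simp
    next
      assume M: "?M = (?t choose 2) + 2 * ?t + k"
      \<comment> \<open>With too many edges, \<open>k\<close> extra vertices get a third path
        neighbour.\<close>
      have "?t + ?t + k + (?t choose 2) = ?M" using M by simp
      then show ?thesis
        using odd_extremal[OF s _ n', of 0 ?t k "?t choose 2"] False kt unfolding m' by simp
    qed
  qed
  ultimately show ?thesis unfolding B' by (metis of_nat_le_iff)
qed

lemma even_bounds:
  assumes n: "card V = n" and m: "card E = m" and even: "even d" and d4: "4 \<le> d"
    and k: "k = (LEAST k::nat. m \<le> n - 1 + (k choose 2) + 2 * k)"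
    and B: "B = (7 * real d ^ 3 - 4 * real d) / 12 + (real m - real d) * (real d)^2 / 4
                + (real n - 1 - real d + real k) * real d / 2"
  shows "real (sigma2 V E) \<ge> B \<and>
    (\<not> (d = 4 \<and> m = n \<and> n \<ge> 7) \<longrightarrow>
      (\<exists>(H :: nat set) F. cgraph_params H F n m d \<and> real (sigma2 H F) = B)) \<and>
    (d = 4 \<and> m = n \<and> n \<ge> 7 \<longrightarrow>
      real (sigma2 V E) \<ge> B + 3 \<and>
      (\<exists>(H :: nat set) F. cgraph_params H F n m d \<and> real (sigma2 H F) = B + 3))"
proof -
  obtain s where s: "d = 2 * s" using even by (elim evenE)
  have s2: "2 \<le> s" using s d4 by simp
  let ?t = "card T" and ?M = "card N"
  have n': "n = d + 1 + ?t" and m': "m = d + ?M" using card_T card_N n m by auto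
  have B': "B = real (path_sum d + s * s * ?M + s * (?t + k))"
    unfolding B by (rule even_bound_eq[OF s m' n'])
  define Q where "Q k \<longleftrightarrow> ?M \<le> ?t + (k choose 2) + 2 * k" for k
  have "(m \<le> n - 1 + (k choose 2) + 2 * k) = Q k" for k unfolding Q_def n' m' by auto
  then have kQ: "k = (LEAST k. Q k)" unfolding k by simp
  \<comment> \<open>This gives \<open>k <= t\<close>, so that there are enough extra vertices to
    build the extremal graph.\<close>
  have Qt: "Q ?t" using card_N_le unfolding Q_def by linarith
  have Qk: "Q k" and kt: "k \<le> ?t" unfolding kQ using Qt by (auto intro: LeastI Least_le)
  have nQ: "\<not> Q j" if "j < k" for j using that not_less_Least unfolding kQ by blast
  have tM: "?t \<le> ?M" using card_N_ge[of s] by (simp add: s[symmetric])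
  have "?t + k \<le> card (bad s)" by (rule bad_even_Least[OF s]) (use kQ Q_def in simp)
  then have "s * (?t + k) \<le> s * card (bad s)" by (rule mult_le_mono2)
  moreover from s have r: "2 * s \<le> d + 1" by simp
  ultimately have lower: "path_sum d + s * s * ?M + s * (?t + k) \<le> sigma2 V E"
    using sigma2_ge[OF r] by linarith
  show ?thesis
  proof (intro conjI impI)
    show "B \<le> real (sigma2 V E)" unfolding B' using lower by (simp only: of_nat_le_iff)
  next
    assume exc: "\<not> (d = 4 \<and> m = n \<and> n \<ge> 7)"
    have "\<exists>(H :: nat set) F. cgraph_params H F n m d \<and>
      sigma2 H F = path_sum d + s * s * ?M + s * (?t + k)"
    \<comment> \<open>With \<open>k\<close> off-path centres all joined to the middle of the path at least \<open>t + 2 k\<close> edges are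
      needed; the only smaller values are \<open>M = t + 1\<close> and \<open>M = t + 3\<close>.\<close>
    proof (cases "?t + 2 * k \<le> ?M")
      case True
      have "?M - ?t - 2 * k \<le> (k choose 2)" using Qk unfolding Q_def by simp
      moreover have "?t + 2 * k + (?M - ?t - 2 * k) = ?M" using True by simp
      ultimately show ?thesis
        using even_extremal[OF s s2 n' kt, of "?M - ?t - 2 * k"] unfolding m' by simp
    next
      case False
      then obtain j where j: "k = Suc j" using tM by (cases k) auto
      have jM: "?t + (j choose 2) + 2 * j < ?M" using nQ[of j] j unfolding Q_def by simp
      \<comment> \<open>\<open>M\<close> lies strictly between \<open>t + C(j,2) + 2 j\<close> and
        \<open>t + 2 j + 2\<close>, which leaves a single value and forces
        \<open>C(j,2) = 0\<close>.\<close>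
      with False j have M: "?M = ?t + 2 * j + 1" and "j choose 2 = 0" by linarith+
      then have "j < 2" using zero_less_binomial_iff[of j 2] by linarith
      then consider "j = 0" | "j = 1" by linarith
      then show ?thesis
      proof cases
        case 1
        \<comment> \<open>The excluded parameters enter here: \<open>M = t + 1\<close> with
          \<open>s = 2\<close> and \<open>t >= 2\<close> means \<open>d = 4\<close>,
          \<open>m = n\<close> and \<open>n >= 7\<close>.\<close>
        have "?t = 1 \<or> 3 \<le> s"
        proof (rule ccontr)
          assume "\<not> ?thesis"
          then have "d = 4" "2 \<le> ?t" using s s2 kt j by auto
          then show False using exc n' m' M 1 by simp
        qed
        then show ?thesis using even_extremal_one[OF s s2 n'] kt j 1 M unfolding m' by simp
      next
        case 2
        then show ?thesis using even_extremal_two[OF s s2 n'] kt j M unfolding m'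
          by (simp add: numeral_eq_Suc)
      qed
    qed
    then show "\<exists>(H :: nat set) F. cgraph_params H F n m d \<and> real (sigma2 H F) = B" unfolding B' by metis
  next
    assume exc: "d = 4 \<and> m = n \<and> n \<ge> 7"
    then have M: "?M = ?t + 1" and t: "2 \<le> ?t" and s': "s = 2" using n' m' s by auto
    have "Q 1" unfolding Q_def M by simp
    then have "k \<le> 1" unfolding kQ by (rule Least_le)
    moreover have "k \<noteq> 0" using Qk M unfolding Q_def by (intro notI) (simp add: binomial_eq_0)
    ultimately have k1: "k = 1" by simp
    have B3: "B + 3 = real (path_sum d + 6 * ?M + 3)" unfolding B' k1 s' M by simp
    show "B + 3 \<le> real (sigma2 V E)"
      unfolding B3 of_nat_le_iff by (rule sigma2_ge_exceptional) (use exc M t in auto)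
    have "path_sum d + s * s * ?t + s * ?t + (s + 1) * (s + 1) = path_sum d + 6 * ?M + 3"
      unfolding s' M by simp
    then show "\<exists>(H :: nat set) F. cgraph_params H F n m d \<and> real (sigma2 H F) = B + 3"
      unfolding B3 using even_extremal_exceptional[OF s s2 n' t] M m' by (metis add.assoc)
  qed
qed

lemma diameter_two_bounds:
  assumes n: "card V = n" and m: "card E = m" and d: "d = 2"
    and lo: "(k choose 2) + k * (n - k) \<le> m"
    and hi: "m < ((k + 1) choose 2) + (k + 1) * (n - (k + 1))"
    and B: "B = (k choose 2) + 2 * k * (n - k) + 4 * (m - ((k choose 2) + k * (n - k)))"
  shows "sigma2 V E \<ge> B \<and> (\<exists>(H :: nat set) F. cgraph_params H F n m d \<and> sigma2 H F = B)"
proof -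
  define nu where "nu k = (k choose 2) + k * (n - k)" for k
  \<comment> \<open>The saving against weight 4 on all edges: 3 for an edge between two dominating
    vertices, 2 for an edge with one dominating end. The index is thus \<open>4 * m - phi j\<close>,
    and the bound is \<open>4 * m - phi k\<close>.\<close>
  define phi where "phi k = 3 * (k choose 2) + 2 * (k * (n - k))" for k
  have nu_phi_Suc: "nu (Suc k) = nu k + (n - Suc k)" "phi k \<le> phi (Suc k)" if less: "k < n" for k
  proof -
    obtain p where "n = Suc k + p" using le_Suc_ex[OF Suc_leI[OF less]] by blast
    then show "nu (Suc k) = nu k + (n - Suc k)" "phi k \<le> phi (Suc k)"
      unfolding nu_def phi_def choose_two_Suc by simp_all
  qed
  have nu_mono: "nu i \<le> nu j" if "i \<le> j" "j \<le> n" for i j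
    by (rule mono_upto[of n nu]) (use that nu_phi_Suc(1) in auto)
  have phi_mono: "phi i \<le> phi j" if "i \<le> j" "j \<le> n" for i j
    by (rule mono_upto[of n phi]) (use that nu_phi_Suc(2) in auto)
  obtain j x where j: "j \<le> n" "m = (j choose 2) + j * (n - j) + x"
    "sigma2 V E = (j choose 2) + 2 * j * (n - j) + 4 * x" "m < (n choose 2)"
  proof -
    have "1 \<le> d" "d \<le> 2" using d by auto
    from diameter_le_2[OF this] obtain j x where j: "j \<le> card V"
      "card E = (j choose 2) + j * (card V - j) + x"
      "sigma2 V E = (j choose 2) + 2 * j * (card V - j) + 4 * x"
      "d = 2 \<Longrightarrow> card E < (card V choose 2)" by blast
    show ?thesis by (rule that[of j x]) (use j d n m in auto)
  qed
  have kn: "k < n"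
  proof (rule ccontr)
    assume "\<not> k < n"
    then have "(n choose 2) \<le> (k choose 2)" by (intro binomial_right_mono) simp
    then show False using lo j by linarith
  qed
  have lo': "nu k \<le> m" and hi': "m < nu (Suc k)" using lo hi by (simp_all add: nu_def)
  \<comment> \<open>With \<open>j\<close> dominating vertices there are at least \<open>nu j\<close>
    edges; since \<open>phi\<close> increases up to \<open>n\<close>, the largest admissible
    \<open>j\<close> is the best.\<close>
  have jk: "j \<le> k"
  proof (rule ccontr)
    assume "\<not> j \<le> k"
    then have "nu (Suc k) \<le> nu j" using j by (intro nu_mono) simp_all
    then show False using hi' j(2) by (simp add: nu_def)
  qed
  obtain y where y: "m = (k choose 2) + k * (n - k) + y" using lo le_Suc_ex by blast
  then have By: "B = (k choose 2) + 2 * (k * (n - k)) + 4 * y" unfolding B by simp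
  have "B + phi k = 4 * m" unfolding By y phi_def by simp
  moreover have "sigma2 V E + phi j = 4 * m" 
  proof -
    have "sigma2 V E = (j choose 2) + 2 * (j * (n - j)) + 4 * x" using j(3) by simp
    then show ?thesis unfolding phi_def j(2) by simp
  qed
  moreover have "phi j \<le> phi k" using jk kn by (intro phi_mono) simp_all
  ultimately have lower: "B \<le> sigma2 V E" by linarith
  \<comment> \<open>A connected graph has at least \<open>n - 1 = nu 1\<close> edges, so
    \<open>k\<close> is not 0 and the extremal graph has a dominating vertex.\<close>
  have "card T \<le> card N" using card_N_ge[of 1] d by simp
  then have "n - 1 \<le> m" using card_T card_N n m by linarith
  moreover have "nu (Suc 0) = n - 1" using nu_phi_Suc(1)[of 0] kn by (simp add: nu_def binomial_eq_0)
  ultimately have "k \<noteq> 0" using hi' by (intro notI) simp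
  \<comment> \<open>\<open>nu\<close> grows by \<open>n - k - 1\<close> from \<open>k\<close> to
    \<open>k + 1\<close>, which is exactly the limit on surplus edges in
    \<open>join_exists\<close>.\<close>
  moreover have "m - nu k + k + 1 < n" using nu_phi_Suc(1)[OF kn] lo' hi' kn by linarith
  ultimately have "\<exists>(H :: nat set) F. cgraph_params H F n m d \<and> sigma2 H F = B"
  proof -
    assume "k \<noteq> 0" and f: "m - nu k + k + 1 < n"
    then have k: "1 \<le> k" "k \<le> n" "2 \<le> n" using kn by auto
    have mk: "(k choose 2) + k * (n - k) + (m - nu k) = m" using lo' by (simp add: nu_def)
    show ?thesis using join_exists[OF k f] kn unfolding mk unfolding B nu_def d by simp
  qed
  then show ?thesis using lower by blast
qed

end

theorem theorem3p2:
  fixes V :: "'a set" and E :: "'a set set" and n m d :: nat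
  assumes G: "cgraph_params V E n m d"
  shows
   "(odd d \<and> 2 * int n - 2 - int d \<le> int m \<and> m \<le> ((n - d) choose 2) + n - 1 \<longrightarrow>
       (let B = (7 * real d ^ 3 - real d + 6) / 12 + (real m - real d) * (real d + 1)^2 / 4 in
         real (sigma2 V E) \<ge> B \<and>
         (\<exists>(H :: nat set) F. cgraph_params H F n m d \<and> real (sigma2 H F) = B)))
  \<and> (\<forall>k::nat. odd d \<and> 1 \<le> k \<and> int k \<le> int n - int d - 1 \<and>
        (int m = 2 * int n - 2 - int d - int k \<or> m = ((n - d) choose 2) + n - 1 + k) \<longrightarrow>
       (let B = (7 * real d ^ 3 - real d + 6) / 12 + (real m - real d) * (real d + 1)^2 / 4
                + real k * (real d + 1) / 2 in
         real (sigma2 V E) \<ge> B \<and>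
         (\<exists>(H :: nat set) F. cgraph_params H F n m d \<and> real (sigma2 H F) = B)))
  \<and> (even d \<and> d \<ge> 4 \<longrightarrow>
       (let k = (LEAST k::nat. m \<le> n - 1 + (k choose 2) + 2 * k);
            B = (7 * real d ^ 3 - 4 * real d) / 12 + (real m - real d) * (real d)^2 / 4
                + (real n - 1 - real d + real k) * real d / 2 in
         real (sigma2 V E) \<ge> B \<and>
         (\<not> (d = 4 \<and> m = n \<and> n \<ge> 7) \<longrightarrow>
            (\<exists>(H :: nat set) F. cgraph_params H F n m d \<and> real (sigma2 H F) = B)) \<and>
         (d = 4 \<and> m = n \<and> n \<ge> 7 \<longrightarrow>
            real (sigma2 V E) \<ge> B + 3 \<and>
            (\<exists>(H :: nat set) F. cgraph_params H F n m d \<and> real (sigma2 H F) = B + 3))))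
  \<and> (\<forall>k::nat. d = 2 \<and> (k choose 2) + k * (n - k) \<le> m \<and> m < ((k + 1) choose 2) + (k + 1) * (n - (k + 1)) \<longrightarrow>
       (let B = (k choose 2) + 2 * k * (n - k) + 4 * (m - ((k choose 2) + k * (n - k))) in
         sigma2 V E \<ge> B \<and>
         (\<exists>(H :: nat set) F. cgraph_params H F n m d \<and> sigma2 H F = B)))"
proof -
  from G have G': "connected_graph V E" "card V = n" "card E = m" "diam V E = d"
    by (simp_all add: cgraph_params_def)
  obtain P where "diametral V E P d" using diametral_exists[OF G'(1,4)] .
  then interpret diametral V E P d .
  show ?thesis
    unfolding Let_def
    apply (intro conjI[OF _ conjI[OF _ conjI]] allI impI)
    subgoal by (elim conjE) (rule odd_interior[OF G'(2,3) _ _ _ refl]; assumption)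
    subgoal by (elim conjE) (rule odd_boundary[OF G'(2,3) _ _ _ _ refl]; assumption)
    subgoal by (elim conjE) (rule even_bounds[OF G'(2,3) _ _ refl refl]; assumption)
    subgoal by (elim conjE) (rule diameter_two_bounds[OF G'(2,3) _ _ _ refl]; assumption)
    done
qed

end
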